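(* Let $p\geq 1$, $0<\varepsilon<2/3<\gamma<1$ and let $x_{0}\geq 1$. Take a function $g:[1,\infty)\to[1,\infty)$ with $g(n)\to\infty$ as $n\to\infty$ so slowly that $$\frac{g(n)}{n^{\gamma-2/3}}\to 0\quad\text{as } n\to\infty.$$ Then there exist $C_{p}>0$ and $n_{*}\geq 2$ such that for all integers $n\geq n_{*}$ and all continuous, non-decreasing functions $f:[0,\infty)\to(0,\infty)$ such that $f(\log t^{2})/t$ is monotonic for $t\geq x_{0}$ one has $$\sup_{0\neq v\in\ell^{p}(\mathbb{Z})}\frac{1}{\|v\|^{p}_{\ell^{p}}}\sum_{\lambda\in\sigma_{\mathrm d}(J)}\frac{\mathrm{dist}(\lambda,[-2,2])^{p}}{|\lambda^{2}-4|^{1/2}}\,f\left(-\log\left(\frac{\mathrm{dist}(\lambda,[-2,2])}{\mathrm{dist}(\lambda,\{-2,2\})}\right)\right)\geq C_{p}\left[F\left(\log(\pi^{2}n^{\varepsilon})\right)-F\left(\log(\pi^{2}g^{2}(n))\right)\right]\geq C_{p}\,f(0)\,\log\frac{n^{\varepsilon}}{g^{2}(n)},$$ where $F(t):=\int_{0}^{t} f(x)\,\mathrm{d}x$ for $t\geq 0$.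
   Context: Given bounded complex sequences $\{a_n\}_{n\in\mathbb{Z}},\{b_n\}_{n\in\mathbb{Z}},\{c_n\}_{n\in\mathbb{Z}}$, the Jacobi operator $J$ is the bounded operator in $\ell^2(\mathbb{Z})$ given by $(Ju)_n=a_{n-1}u_{n-1}+b_nu_n+c_nu_{n+1}$, $n\in\mathbb{Z}$. Associated with $J$ is the sequence $v=\{v_n\}_{n\in\mathbb{Z}}$, $$v_n:=\max\{|a_{n-1}-1|,|a_n-1|,|b_n|,|c_{n-1}-1|,|c_n-1|\}.$$ If $v_n\to0$ as $|n|\to\infty$, then the essential spectrum of $J$ is $[-2,2]$; $\sigma_{\mathrm d}(J)\subset\mathbb{C}\setminus[-2,2]$ denotes the discrete spectrum (isolated eigenvalues of finite algebraic multiplicity). In sums over $\sigma_{\mathrm d}(J)$ each eigenvalue is repeated according to its algebraic multiplicity. The supremum over $0\neq v\in\ell^p(\mathbb{Z})$ means the supremum over all Jacobi operators $J$ whose associated sequence $v$ is non-zero and belongs to $\ell^p(\mathbb{Z})$. The subscript in $C_p$ indicates that this constant depends only on $p$. $g^2(n)$ means $(g(n))^2$.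
   Formalization: The last inequality, C_p[F(log(π²n^ε)) − F(log(π²g²(n)))] ≥ C_p f(0) log(n^ε/g²(n)), is claimed only when g²(n) ≤ n^ε, since it fails otherwise (e.g. f(x)=e^{x/2}, g(x)=x^{0.1}, ε=0.01, γ=0.99); the supremum is bounded below by both expressions unconditionally. *)

theory Defs
  imports "HOL-Complex_Analysis.Complex_Analysis" "HOL-Library.Function_Algebras"
begin

text \<open>Operators are plain functions on bi-infinite sequences; every notion below only looks at
  their action on the carrier \<open>ell2\<close>.\<close>

definition ell2 :: "(int \<Rightarrow> complex) set" where
  "ell2 = {u. (\<lambda>n. (cmod (u n))\<^sup>2) summable_on UNIV}"

definition ell2_norm :: "(int \<Rightarrow> complex) \<Rightarrow> real" where
  "ell2_norm u = sqrt (\<Sum>\<^sub>\<infinity>n. (cmod (u n))\<^sup>2)"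

definition lp_seq :: "real \<Rightarrow> (int \<Rightarrow> real) \<Rightarrow> bool" where
  "lp_seq p v \<longleftrightarrow> (\<lambda>n. \<bar>v n\<bar> powr p) summable_on UNIV"

definition lp_norm :: "real \<Rightarrow> (int \<Rightarrow> real) \<Rightarrow> real" where
  "lp_norm p v = (\<Sum>\<^sub>\<infinity>n. \<bar>v n\<bar> powr p) powr (1 / p)"

definition scale_seq :: "complex \<Rightarrow> (int \<Rightarrow> complex) \<Rightarrow> int \<Rightarrow> complex" where
  "scale_seq k u = (\<lambda>n. k * u n)"

global_interpretation cseq: vector_space scale_seq
  by unfold_locales (auto simp: scale_seq_def fun_eq_iff algebra_simps)

type_synonym seq_op = "(int \<Rightarrow> complex) \<Rightarrow> int \<Rightarrow> complex"

definition shifted_op :: "seq_op \<Rightarrow> complex \<Rightarrow> seq_op" where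
  "shifted_op T z u = T u - scale_seq z u"

text \<open>\<open>resolvent T z\<close> is $(T - z)^{-1}$ on $\ell^2$; it is meaningful only for \<open>z\<close> in the resolvent set.\<close>

definition resolvent :: "seq_op \<Rightarrow> complex \<Rightarrow> seq_op" where
  "resolvent T z = inv_into ell2 (shifted_op T z)"

definition resolvent_set :: "seq_op \<Rightarrow> complex set" where
  "resolvent_set T = {z. bij_betw (shifted_op T z) ell2 ell2 \<and>
     (\<exists>K. \<forall>u\<in>ell2. ell2_norm (resolvent T z u) \<le> K * ell2_norm u)}"

definition spectrum :: "seq_op \<Rightarrow> complex set" where
  "spectrum T = - resolvent_set T"

definition eigenvalue :: "seq_op \<Rightarrow> complex \<Rightarrow> bool" where
  "eigenvalue T z \<longleftrightarrow> (\<exists>u\<in>ell2. u \<noteq> 0 \<and> T u = scale_seq z u)"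

text \<open>The Riesz projection $-\frac{1}{2\pi i}\oint_{|z-w|=r} (T - z)^{-1}\,dz$ of an isolated
  point \<open>w\<close> of the spectrum, for small \<open>r\<close>, with the integral taken entrywise: \<open>residue\<close> is by
  definition the value of $\frac{1}{2\pi i}\oint$ over all sufficiently small circles.
  Its rank is the algebraic multiplicity.\<close>

definition riesz_proj :: "seq_op \<Rightarrow> complex \<Rightarrow> seq_op" where
  "riesz_proj T w u = (\<lambda>n. - residue (\<lambda>z. resolvent T z u n) w)"

definition finite_alg_mult :: "seq_op \<Rightarrow> complex \<Rightarrow> bool" where
  "finite_alg_mult T w \<longleftrightarrow> (\<exists>B. finite B \<and> riesz_proj T w ` ell2 \<subseteq> cseq.span B)"

definition alg_mult :: "seq_op \<Rightarrow> complex \<Rightarrow> nat" where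
  "alg_mult T w = cseq.dim (riesz_proj T w ` ell2)"

definition discrete_spectrum :: "seq_op \<Rightarrow> complex set" where
  "discrete_spectrum T =
     {w. w isolated_in spectrum T \<and> eigenvalue T w \<and> finite_alg_mult T w}"

definition jacobi :: "(int \<Rightarrow> complex) \<Rightarrow> (int \<Rightarrow> complex) \<Rightarrow> (int \<Rightarrow> complex) \<Rightarrow> seq_op" where
  "jacobi a b c u = (\<lambda>n. a (n - 1) * u (n - 1) + b n * u n + c n * u (n + 1))"

definition jacobi_seq ::
  "(int \<Rightarrow> complex) \<Rightarrow> (int \<Rightarrow> complex) \<Rightarrow> (int \<Rightarrow> complex) \<Rightarrow> int \<Rightarrow> real" where
  "jacobi_seq a b c n =
     Max {cmod (a (n - 1) - 1), cmod (a n - 1), cmod (b n), cmod (c (n - 1) - 1), cmod (c n - 1)}"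

definition dist_interval :: "complex \<Rightarrow> real" where
  "dist_interval w = infdist w (complex_of_real ` {-2..2})"

definition dist_endpoints :: "complex \<Rightarrow> real" where
  "dist_endpoints w = infdist w {-2, 2}"

text \<open>Sums and suprema are taken in \<open>ennreal\<close>, since they may be infinite; each eigenvalue is
  weighted by its algebraic multiplicity.\<close>

definition LT_sum :: "real \<Rightarrow> (real \<Rightarrow> real) \<Rightarrow> seq_op \<Rightarrow> ennreal" where
  "LT_sum p f J = (\<Sum>\<^sub>\<infinity>w\<in>discrete_spectrum J. of_nat (alg_mult J w) *
     ennreal (dist_interval w powr p / cmod (w\<^sup>2 - 4) powr (1 / 2) *
       f (- ln (dist_interval w / dist_endpoints w))))"

definition LT_sup :: "real \<Rightarrow> (real \<Rightarrow> real) \<Rightarrow> ennreal" where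
  "LT_sup p f = (SUP (a, b, c) \<in> {(a, b, c).
       bounded (range a) \<and> bounded (range b) \<and> bounded (range c) \<and>
       jacobi_seq a b c \<noteq> (\<lambda>n. 0) \<and> lp_seq p (jacobi_seq a b c)}.
     ennreal (1 / lp_norm p (jacobi_seq a b c) powr p) * LT_sum p f (jacobi a b c))"

definition primitive :: "(real \<Rightarrow> real) \<Rightarrow> real \<Rightarrow> real" where
  "primitive f t = integral {0..t} f"

end

theory Submission
  imports Defs
begin

text \<open>
  The supremum in question is infinite, already for a positive constant function \<open>f\<close>. Given this, the two
  lower bounds for it hold with the constant 1 and for all \<open>n \<ge> 2\<close>, and they compare because
  \<open>f \<ge> f 0\<close> under the integral (\<open>primitive_diff_ge\<close>).

  The supremum is infinite because of the barrier operators: on the sites \<open>1, ..., n\<close> the diagonal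
  is \<open>i h\<close>, elsewhere it vanishes; the off-diagonal entries are 1 except that the two bonds at the
  ends of this block are cut. The operator is then the direct sum of two free half-lines and a
  finite matrix with the eigenvalues \<open>2 cos \<theta>\<^sub>j + i h\<close>, \<open>\<theta>\<^sub>j = \<pi> j / (n + 1)\<close>, \<open>j = 1, ..., n\<close>. All
  of them are simple points of the discrete spectrum (\<open>barrier_eigenvalue_discrete\<close>), at distance
  \<open>h\<close> or more from the interval, and \<open>|\<lambda>\<^sub>j\<^sup>2 - 4|\<close> is at most of the order of \<open>(j / n)\<^sup>2 + h\<close>. Hence the
  eigenvalues with \<open>j / n \<ge> \<surd>h\<close> contribute to the sum at least a constant times
  \<open>h\<^sup>p \<Sum> n / j\<close>, that is \<open>n h\<^sup>p log (1 / h)\<close>, whereas \<open>\<parallel>v\<parallel>\<^sup>p\<close> is at most \<open>n h\<^sup>p + 4\<close>. For each fixed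
  \<open>h\<close> one chooses \<open>n\<close> so large that the cuts, which cost only 4, do not matter; then the quotient
  exceeds a multiple of \<open>log (1 / h)\<close>, which is unbounded as \<open>h\<close> tends to 0.

  To identify the Riesz projections, the resolvent of the barrier operator in the upper half-plane
  is written as the resolvent of a symmetric operator off the block plus the expansion into sine
  modes on the block (\<open>barrier_resolvent_correct\<close>). The former exists and is holomorphic by
  self-adjointness (\<open>sym_jacobi_resolvent\<close>, \<open>sym_jacobi_resolvent_holomorphic\<close>); surjectivity comes
  from a contraction argument in the complete space \<open>\<ell>\<^sup>2\<close>. The latter has simple poles with
  residues of rank one.
\<close>

section \<open>The Hilbert space of square-summable sequences\<close>

lemma ell2_norm_nonneg [simp]: "0 \<le> ell2_norm u"
  unfolding ell2_norm_def by (intro real_sqrt_ge_zero infsum_nonneg) auto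

lemma ell2_norm_power2: "(ell2_norm u)\<^sup>2 = (\<Sum>\<^sub>\<infinity>k. (cmod (u k))\<^sup>2)"
  unfolding ell2_norm_def by (intro real_sqrt_pow2 infsum_nonneg) auto

lemma ell2_has_sum: "u \<in> ell2 \<Longrightarrow> ((\<lambda>k. (cmod (u k))\<^sup>2) has_sum (ell2_norm u)\<^sup>2) UNIV"
  unfolding ell2_norm_power2 ell2_def by simp

lemma L2_set_le_ell2_norm:
  assumes "u \<in> ell2" "finite F"
  shows "L2_set (\<lambda>k. cmod (u k)) F \<le> ell2_norm u"
  unfolding L2_set_def ell2_norm_def
  using assms by (intro real_sqrt_le_mono finite_sum_le_infsum) (auto simp: ell2_def)

lemma norm_le_ell2_norm: "u \<in> ell2 \<Longrightarrow> cmod (u k) \<le> ell2_norm u"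
  using L2_set_le_ell2_norm[of u "{k}"] by simp

text \<open>Together with \<open>L2_set_le_ell2_norm\<close> this characterises membership in
  \<open>ell2\<close> and the norm by finite partial sums.\<close>

lemma ell2_bounded_partial_sums:
  assumes "\<And>F. finite F \<Longrightarrow> L2_set (\<lambda>k. cmod (u k)) F \<le> B"
  shows "u \<in> ell2" "ell2_norm u \<le> B"
proof -
  have B: "0 \<le> B" using assms[of "{}"] by simp
  have le: "(\<Sum>k\<in>F. (cmod (u k))\<^sup>2) \<le> B\<^sup>2" if "finite F" for F
    using assms[OF that] B unfolding L2_set_def by (simp add: sqrt_le_D)
  have s: "(\<lambda>k. (cmod (u k))\<^sup>2) summable_on UNIV"
    by (rule nonneg_bdd_above_summable_on) (auto intro!: bdd_aboveI[of _ "B\<^sup>2"] le)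
  then show "u \<in> ell2" by (simp add: ell2_def)
  have "(\<Sum>\<^sub>\<infinity>k. (cmod (u k))\<^sup>2) \<le> B\<^sup>2"
    by (rule infsum_le_finite_sums[OF s]) (auto intro: le)
  then show "ell2_norm u \<le> B"
    unfolding ell2_norm_def using B by (simp add: real_le_lsqrt)
qed

lemma ell2_mult_bounded:
  assumes "u \<in> ell2" "\<And>k. cmod (c k) \<le> C"
  shows "(\<lambda>k. c k * u k) \<in> ell2" "ell2_norm (\<lambda>k. c k * u k) \<le> C * ell2_norm u"
proof -
  have C: "0 \<le> C" using assms(2)[of 0] norm_ge_zero order_trans by blast
  have "L2_set (\<lambda>k. cmod (c k * u k)) F \<le> C * ell2_norm u" if "finite F" for F
  proof -
    have "L2_set (\<lambda>k. cmod (c k * u k)) F \<le> L2_set (\<lambda>k. C * cmod (u k)) F"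
      by (rule L2_set_mono) (auto simp: norm_mult intro!: mult_right_mono assms(2))
    also have "\<dots> = C * L2_set (\<lambda>k. cmod (u k)) F"
      by (simp add: L2_set_right_distrib C)
    also have "\<dots> \<le> C * ell2_norm u"
      by (intro mult_left_mono L2_set_le_ell2_norm assms that C)
    finally show ?thesis .
  qed
  then show "(\<lambda>k. c k * u k) \<in> ell2" "ell2_norm (\<lambda>k. c k * u k) \<le> C * ell2_norm u"
    by (auto intro!: ell2_bounded_partial_sums)
qed

lemma ell2_scale: "u \<in> ell2 \<Longrightarrow> (\<lambda>k. c * u k) \<in> ell2"
  and ell2_norm_scale_le: "u \<in> ell2 \<Longrightarrow> ell2_norm (\<lambda>k. c * u k) \<le> cmod c * ell2_norm u"
  using ell2_mult_bounded[of u "\<lambda>_. c" "cmod c"] by auto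

lemma ell2_add:
  assumes "u \<in> ell2" "v \<in> ell2"
  shows "(\<lambda>k. u k + v k) \<in> ell2" "ell2_norm (\<lambda>k. u k + v k) \<le> ell2_norm u + ell2_norm v"
proof -
  have "L2_set (\<lambda>k. cmod (u k + v k)) F \<le> ell2_norm u + ell2_norm v" if "finite F" for F
  proof -
    have "L2_set (\<lambda>k. cmod (u k + v k)) F \<le> L2_set (\<lambda>k. cmod (u k) + cmod (v k)) F"
      by (rule L2_set_mono) (auto simp: norm_triangle_ineq)
    also have "\<dots> \<le> L2_set (\<lambda>k. cmod (u k)) F + L2_set (\<lambda>k. cmod (v k)) F"
      by (rule L2_set_triangle_ineq)
    also have "\<dots> \<le> ell2_norm u + ell2_norm v"
      by (intro add_mono L2_set_le_ell2_norm assms that)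
    finally show ?thesis .
  qed
  then show "(\<lambda>k. u k + v k) \<in> ell2" "ell2_norm (\<lambda>k. u k + v k) \<le> ell2_norm u + ell2_norm v"
    by (auto intro!: ell2_bounded_partial_sums)
qed

lemma ell2_diff:
  assumes "u \<in> ell2" "v \<in> ell2"
  shows "(\<lambda>k. u k - v k) \<in> ell2" "ell2_norm (\<lambda>k. u k - v k) \<le> ell2_norm u + ell2_norm v"
  using ell2_add[OF assms(1) ell2_scale[OF assms(2), of "-1"]] ell2_norm_scale_le[OF assms(2), of "-1"]
  by auto

lemma ell2_shift:
  assumes "u \<in> ell2"
  shows "(\<lambda>k. u (k + m)) \<in> ell2" "ell2_norm (\<lambda>k. u (k + m)) \<le> ell2_norm u"
proof -
  have "L2_set (\<lambda>k. cmod (u (k + m))) F \<le> ell2_norm u" if "finite F" for F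
  proof -
    have "L2_set (\<lambda>k. cmod (u (k + m))) F = L2_set (\<lambda>k. cmod (u k)) ((\<lambda>k. k + m) ` F)"
      unfolding L2_set_def by (subst sum.reindex) (auto simp: inj_on_def)
    also have "\<dots> \<le> ell2_norm u"
      using that assms by (intro L2_set_le_ell2_norm) auto
    finally show ?thesis .
  qed
  then show "(\<lambda>k. u (k + m)) \<in> ell2" "ell2_norm (\<lambda>k. u (k + m)) \<le> ell2_norm u"
    by (auto intro!: ell2_bounded_partial_sums)
qed

lemma ell2_finite_support:
  assumes "finite S" "\<And>k. k \<notin> S \<Longrightarrow> u k = 0"
  shows "u \<in> ell2"
proof -
  have "(\<lambda>k. (cmod (u k))\<^sup>2) summable_on S" using assms(1) by simp
  then show ?thesis unfolding ell2_def
    by (subst mem_Collect_eq, subst summable_on_cong_neutral[where T = S and g = "\<lambda>k. (cmod (u k))\<^sup>2"])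
       (auto simp: assms(2))
qed

lemma ell2_zero [simp]: "(\<lambda>k. 0) \<in> ell2" "ell2_norm (\<lambda>k. 0) = 0"
  by (auto simp: ell2_def ell2_norm_def)

lemma ell2_sum:
  assumes "finite S" "\<And>i. i \<in> S \<Longrightarrow> u i \<in> ell2"
  shows "(\<lambda>k. \<Sum>i\<in>S. u i k) \<in> ell2"
    and "ell2_norm (\<lambda>k. \<Sum>i\<in>S. u i k) \<le> (\<Sum>i\<in>S. ell2_norm (u i))"
proof -
  have "(\<lambda>k. \<Sum>i\<in>S. u i k) \<in> ell2 \<and> ell2_norm (\<lambda>k. \<Sum>i\<in>S. u i k) \<le> (\<Sum>i\<in>S. ell2_norm (u i))"
    using assms
  proof (induction S rule: finite_induct)
    case (insert x F)
    then show ?case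
      using ell2_add[of "u x" "\<lambda>k. \<Sum>i\<in>F. u i k"] by force
  qed simp
  then show "(\<lambda>k. \<Sum>i\<in>S. u i k) \<in> ell2" 
    and "ell2_norm (\<lambda>k. \<Sum>i\<in>S. u i k) \<le> (\<Sum>i\<in>S. ell2_norm (u i))" by auto
qed

lemma ell2_norm_eq_0: "u \<in> ell2 \<Longrightarrow> ell2_norm u \<le> 0 \<Longrightarrow> u = (\<lambda>k. 0)"
  using norm_le_ell2_norm[of u] by (metis norm_le_zero_iff order_trans ext)

lemma ell2_norm_minus_commute: "ell2_norm (\<lambda>k. u k - v k) = ell2_norm (\<lambda>k. v k - u k)"
  by (simp add: ell2_norm_def norm_minus_commute)

interpretation ell2: Metric_space ell2 "\<lambda>u v. ell2_norm (\<lambda>k. u k - v k)"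
proof
  show "ell2_norm (\<lambda>k. u k - v k) = 0 \<longleftrightarrow> u = v" if "u \<in> ell2" "v \<in> ell2" for u v
    using ell2_norm_eq_0[OF ell2_diff(1)[OF that]] by (auto simp: fun_eq_iff)
  show "ell2_norm (\<lambda>k. u k - w k) \<le> ell2_norm (\<lambda>k. u k - v k) + ell2_norm (\<lambda>k. v k - w k)"
    if "u \<in> ell2" "v \<in> ell2" "w \<in> ell2" for u v w
    using ell2_add(2)[OF ell2_diff(1)[OF that(1,2)] ell2_diff(1)[OF that(2,3)]] by simp
qed (auto intro: ell2_norm_minus_commute)

text \<open>A Cauchy sequence converges entrywise, and bounds on finite partial sums pass to the limit.\<close>

lemma ell2_complete: "ell2.mcomplete"
  unfolding ell2.mcomplete_def
proof (intro allI impI)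
  fix \<sigma> :: "nat \<Rightarrow> int \<Rightarrow> complex"
  assume \<sigma>: "ell2.MCauchy \<sigma>"
  have mem: "\<sigma> i \<in> ell2" for i using \<sigma> by (auto simp: ell2.MCauchy_def)
  have C: "\<exists>N. \<forall>i j. N \<le> i \<longrightarrow> N \<le> j \<longrightarrow> ell2_norm (\<lambda>k. \<sigma> i k - \<sigma> j k) < e" if "e > 0" for e
    using \<sigma> that by (auto simp: ell2.MCauchy_def)
  have "Cauchy (\<lambda>i. \<sigma> i k)" for k
  proof (rule CauchyI)
    fix e :: real assume "0 < e"
    from C[OF this] obtain N
      where "\<And>i j. N \<le> i \<Longrightarrow> N \<le> j \<Longrightarrow> ell2_norm (\<lambda>k. \<sigma> i k - \<sigma> j k) < e" by blast
    then show "\<exists>N. \<forall>i\<ge>N. \<forall>j\<ge>N. cmod (\<sigma> i k - \<sigma> j k) < e"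
      using norm_le_ell2_norm[OF ell2_diff(1)[OF mem mem]] by (meson le_less_trans)
  qed
  then have "\<forall>k. \<exists>l. (\<lambda>i. \<sigma> i k) \<longlonglongrightarrow> l"
    using Cauchy_convergent_iff convergent_def by blast
  then obtain u where u: "\<And>k. (\<lambda>i. \<sigma> i k) \<longlonglongrightarrow> u k" by metis
  have close: "\<exists>N. \<forall>i\<ge>N. (\<lambda>k. \<sigma> i k - u k) \<in> ell2 \<and> ell2_norm (\<lambda>k. \<sigma> i k - u k) \<le> e"
    if "e > 0" for e
  proof -
    from C[OF that] obtain N
      where N: "\<And>i j. N \<le> i \<Longrightarrow> N \<le> j \<Longrightarrow> ell2_norm (\<lambda>k. \<sigma> i k - \<sigma> j k) < e" by blast
    have "L2_set (\<lambda>k. cmod (\<sigma> i k - u k)) F \<le> e" if "N \<le> i" "finite F" for i F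
    proof (rule tendsto_upperbound)
      show "(\<lambda>j. L2_set (\<lambda>k. cmod (\<sigma> i k - \<sigma> j k)) F) \<longlonglongrightarrow> L2_set (\<lambda>k. cmod (\<sigma> i k - u k)) F"
        unfolding L2_set_def by (intro tendsto_intros u)
      show "\<forall>\<^sub>F j in sequentially. L2_set (\<lambda>k. cmod (\<sigma> i k - \<sigma> j k)) F \<le> e"
        using eventually_ge_at_top[of N]
      proof eventually_elim
        case (elim j)
        then show ?case
          using L2_set_le_ell2_norm[OF ell2_diff(1)[OF mem mem] that(2), of i j] N[OF that(1) elim] 
          by linarith
      qed
    qed auto
    then show ?thesis
      using ell2_bounded_partial_sums[where B = e and u = "\<lambda>k. \<sigma> _ k - u k"] by blast
  qed
  obtain N where "(\<lambda>k. \<sigma> N k - u k) \<in> ell2" using close[of 1] by auto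
  from ell2_diff(1)[OF mem[of N] this] have "u \<in> ell2" by simp
  moreover have "\<exists>N. \<forall>i\<ge>N. \<sigma> i \<in> ell2 \<and> ell2_norm (\<lambda>k. \<sigma> i k - u k) < e" if e: "e > 0" for e
  proof -
    obtain N where "\<forall>i\<ge>N. ell2_norm (\<lambda>k. \<sigma> i k - u k) \<le> e / 2"
      using close[of "e / 2"] half_gt_zero[OF e] by blast
    moreover have "e / 2 < e" using e by simp
    ultimately have "\<forall>i\<ge>N. ell2_norm (\<lambda>k. \<sigma> i k - u k) < e"
      using le_less_trans by blast
    then show ?thesis using mem by blast
  qed
  ultimately have "limitin ell2.mtopology \<sigma> u sequentially"
    by (simp add: ell2.limit_metric_sequentially)
  then show "\<exists>u. limitin ell2.mtopology \<sigma> u sequentially" by blast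
qed

lemma ell2_contraction_equation:
  assumes "\<And>u. u \<in> ell2 \<Longrightarrow> T u \<in> ell2"
    and "\<And>u v. u \<in> ell2 \<Longrightarrow> v \<in> ell2 \<Longrightarrow>
           ell2_norm (\<lambda>k. T u k - T v k) \<le> q * ell2_norm (\<lambda>k. u k - v k)"
    and "q < 1" "f \<in> ell2"
  obtains u where "u \<in> ell2" "\<And>k. u k = T u k + f k"
proof -
  have "(\<lambda>k. 0) \<in> ell2" by simp
  then have ne: "ell2 \<noteq> {}" by blast
  have maps: "(\<lambda>u k. T u k + f k) \<in> ell2 \<rightarrow> ell2"
    using assms by (auto intro!: ell2_add)
  obtain u where "u \<in> ell2" "(\<lambda>k. T u k + f k) = u"
    by (rule ell2.Banach_fixedpoint_thm[OF ell2_complete ne maps \<open>q < 1\<close>]) (use assms(2) in auto)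
  then show ?thesis using that by (metis (no_types, lifting))
qed

section \<open>Resolvents of symmetric Jacobi operators in the upper half-plane\<close>

text \<open>The Jacobi operator with zero diagonal and the same real off-diagonal sequence on both sides.
  It is called \<open>A\<close> in comments, and its resolvent \<open>R\<close>.\<close>

definition sym_jacobi :: "(int \<Rightarrow> real) \<Rightarrow> seq_op" where
  "sym_jacobi \<alpha> = jacobi (\<lambda>k. of_real (\<alpha> k)) (\<lambda>k. 0) (\<lambda>k. of_real (\<alpha> k))"

lemma sym_jacobi_apply:
  "sym_jacobi \<alpha> u k = of_real (\<alpha> (k - 1)) * u (k - 1) + of_real (\<alpha> k) * u (k + 1)"
  by (simp add: sym_jacobi_def jacobi_def)

lemma shifted_op_apply: "shifted_op T z u k = T u k - z * u k"
  by (simp add: shifted_op_def scale_seq_def)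

lemma sym_jacobi_diff: "sym_jacobi \<alpha> (\<lambda>k. u k - v k) k = sym_jacobi \<alpha> u k - sym_jacobi \<alpha> v k"
  and sym_jacobi_add: "sym_jacobi \<alpha> (\<lambda>k. u k + v k) k = sym_jacobi \<alpha> u k + sym_jacobi \<alpha> v k"
  and sym_jacobi_scale: "sym_jacobi \<alpha> (\<lambda>k. c * u k) k = c * sym_jacobi \<alpha> u k"
  by (simp_all add: sym_jacobi_apply algebra_simps)

lemma sym_jacobi_ell2:
  assumes "\<forall>k. \<bar>\<alpha> k\<bar> \<le> 1" "u \<in> ell2"
  shows "sym_jacobi \<alpha> u \<in> ell2" "ell2_norm (sym_jacobi \<alpha> u) \<le> 2 * ell2_norm u"
proof -
  have 1: "(\<lambda>k. of_real (\<alpha> (k - 1)) * u (k - 1)) \<in> ell2"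
      "ell2_norm (\<lambda>k. of_real (\<alpha> (k - 1)) * u (k - 1)) \<le> ell2_norm u"
    using ell2_mult_bounded[of "\<lambda>k. u (k - 1)" "\<lambda>k. of_real (\<alpha> (k - 1))" 1]
      ell2_shift[OF assms(2), of "-1"] assms(1) by auto
  have 2: "(\<lambda>k. of_real (\<alpha> k) * u (k + 1)) \<in> ell2"
      "ell2_norm (\<lambda>k. of_real (\<alpha> k) * u (k + 1)) \<le> ell2_norm u"
    using ell2_mult_bounded[of "\<lambda>k. u (k + 1)" "\<lambda>k. of_real (\<alpha> k)" 1]
      ell2_shift[OF assms(2), of 1] assms(1) by auto
  have eq: "sym_jacobi \<alpha> u = (\<lambda>k. of_real (\<alpha> (k - 1)) * u (k - 1) + of_real (\<alpha> k) * u (k + 1))"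
    by (simp add: fun_eq_iff sym_jacobi_apply)
  show "sym_jacobi \<alpha> u \<in> ell2" unfolding eq by (rule ell2_add(1)[OF 1(1) 2(1)])
  show "ell2_norm (sym_jacobi \<alpha> u) \<le> 2 * ell2_norm u" 
    unfolding eq using ell2_add(2)[OF 1(1) 2(1)] 1(2) 2(2) by linarith
qed

text \<open>The quadratic form of a symmetric operator is real: the imaginary parts telescope.\<close>

lemma sym_jacobi_form_real:
  assumes \<alpha>: "\<forall>k. \<bar>\<alpha> k\<bar> \<le> 1" and u: "u \<in> ell2"
  shows "((\<lambda>k. Im (sym_jacobi \<alpha> u k * cnj (u k))) has_sum 0) UNIV"
proof -
  define W where "W k = \<alpha> k * Im (u k * cnj (u (k + 1)))" for k
  have "(\<lambda>k. (cmod (u k))\<^sup>2 + (cmod (u (k + 1)))\<^sup>2) summable_on UNIV"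
    using u ell2_shift(1)[OF u, of 1] by (intro summable_on_add) (auto simp: ell2_def)
  then have "(\<lambda>k. norm (W k)) summable_on UNIV"
  proof (rule summable_on_comparison_test)
    fix k
    have "\<bar>Im (u k * cnj (u (k + 1)))\<bar> \<le> cmod (u k) * cmod (u (k + 1))"
      by (metis abs_Im_le_cmod complex_mod_cnj norm_mult)
    also have "\<dots> \<le> (cmod (u k))\<^sup>2 + (cmod (u (k + 1)))\<^sup>2"
    proof -
      have "2 * (cmod (u k) * cmod (u (k + 1))) \<le> (cmod (u k))\<^sup>2 + (cmod (u (k + 1)))\<^sup>2"
        using sum_squares_bound[of "cmod (u k)" "cmod (u (k + 1))"] by (simp add: mult.assoc)
      moreover have "0 \<le> cmod (u k) * cmod (u (k + 1))" by simp
      ultimately show ?thesis by linarith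
    qed
    finally show "norm (W k) \<le> (cmod (u k))\<^sup>2 + (cmod (u (k + 1)))\<^sup>2"
      unfolding W_def using mult_left_le_one_le[OF abs_ge_zero abs_ge_zero spec[OF \<alpha>, of k], of "Im (u k * cnj (u (k + 1)))"]
      by (simp add: abs_mult)
  qed auto
  then obtain s where s: "(W has_sum s) UNIV"
    using summable_on_iff_abs_summable_on_real summable_on_def by blast
  have "((\<lambda>k. W (k - 1)) has_sum s) UNIV"
    using s by (subst has_sum_reindex_bij_witness[of UNIV "\<lambda>k. k + 1" "\<lambda>k. k - 1" UNIV]) auto
  moreover have "((\<lambda>k. - W k) has_sum (- s)) UNIV"
    using s by (simp add: has_sum_uminus)
  ultimately have "((\<lambda>k. W (k - 1) + - W k) has_sum (s + - s)) UNIV"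
    by (rule has_sum_add)
  moreover have "W (k - 1) + - W k = Im (sym_jacobi \<alpha> u k * cnj (u k))" for k
    by (simp add: W_def sym_jacobi_apply algebra_simps)
  ultimately show ?thesis by simp
qed

text \<open>Consequently \<open>(A - x) u\<close> and \<open>i s u\<close> are orthogonal for the real inner product, for all
  real \<open>x\<close> and \<open>s\<close>.\<close>

lemma sym_jacobi_pythagoras:
  fixes x s :: real
  assumes \<alpha>: "\<forall>k. \<bar>\<alpha> k\<bar> \<le> 1" and u: "u \<in> ell2"
  shows "(ell2_norm (\<lambda>k. sym_jacobi \<alpha> u k - (of_real x - \<i> * of_real s) * u k))\<^sup>2 =
         (ell2_norm (\<lambda>k. sym_jacobi \<alpha> u k - of_real x * u k))\<^sup>2 + s\<^sup>2 * (ell2_norm u)\<^sup>2"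
proof -
  have mem: "(\<lambda>k. sym_jacobi \<alpha> u k - c * u k) \<in> ell2" for c
    by (intro ell2_diff(1) ell2_scale u sym_jacobi_ell2(1) \<alpha>)
  have "((\<lambda>k. (cmod (sym_jacobi \<alpha> u k - of_real x * u k))\<^sup>2 + s\<^sup>2 * (cmod (u k))\<^sup>2
            + 2 * s * Im (sym_jacobi \<alpha> u k * cnj (u k))) has_sum
         (ell2_norm (\<lambda>k. sym_jacobi \<alpha> u k - of_real x * u k))\<^sup>2 + s\<^sup>2 * (ell2_norm u)\<^sup>2 + 2 * s * 0) UNIV"
    by (intro has_sum_add has_sum_cmult_right ell2_has_sum mem u sym_jacobi_form_real \<alpha>)
  moreover have "(cmod (sym_jacobi \<alpha> u k - of_real x * u k))\<^sup>2 + s\<^sup>2 * (cmod (u k))\<^sup>2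
            + 2 * s * Im (sym_jacobi \<alpha> u k * cnj (u k)) =
         (cmod (sym_jacobi \<alpha> u k - (of_real x - \<i> * of_real s) * u k))\<^sup>2" for k
    unfolding cmod_power2 by (simp add: power2_eq_square algebra_simps)
  ultimately have "((\<lambda>k. (cmod (sym_jacobi \<alpha> u k - (of_real x - \<i> * of_real s) * u k))\<^sup>2) has_sum
         (ell2_norm (\<lambda>k. sym_jacobi \<alpha> u k - of_real x * u k))\<^sup>2 + s\<^sup>2 * (ell2_norm u)\<^sup>2) UNIV"
    by simp
  then show ?thesis
    by (rule has_sum_unique[OF ell2_has_sum[OF mem[of "of_real x - \<i> * of_real s"]]])
qed

lemma sym_jacobi_resolvent_lower_bound:
  assumes \<alpha>: "\<forall>k. \<bar>\<alpha> k\<bar> \<le> 1" and u: "u \<in> ell2" and z: "Im z > 0"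
  shows "Im z * ell2_norm u \<le> ell2_norm (shifted_op (sym_jacobi \<alpha>) z u)"
proof -
  have eq: "shifted_op (sym_jacobi \<alpha>) z u = 
        (\<lambda>k. sym_jacobi \<alpha> u k - (of_real (Re z) - \<i> * of_real (- Im z)) * u k)"
    by (simp add: fun_eq_iff shifted_op_apply complex_eq_iff)
  have "(Im z * ell2_norm u)\<^sup>2 \<le> (ell2_norm (shifted_op (sym_jacobi \<alpha>) z u))\<^sup>2"
    unfolding eq sym_jacobi_pythagoras[OF \<alpha> u] by (simp add: power_mult_distrib)
  then show ?thesis by (rule power2_le_imp_le) simp
qed

lemma sym_jacobi_resolvent_exists:
  assumes \<alpha>: "\<forall>k. \<bar>\<alpha> k\<bar> \<le> 1" and f: "f \<in> ell2" and z: "Im z > 0"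
  obtains u where "u \<in> ell2" "shifted_op (sym_jacobi \<alpha>) z u = f"
proof -
  define x y where "x = Re z" and "y = Im z"
  define M where "M = 2 + \<bar>x\<bar>"
  \<comment> \<open>Shifting far along the imaginary axis turns the equation into a contraction: by
    orthogonality, and as \<open>\<parallel>A - x\<parallel> \<le> M\<close>, the norm of \<open>A - x + i s\<close> is at most the root of
    \<open>M\<^sup>2 + s\<^sup>2\<close>, which is smaller than
    \<open>R = s + y\<close> once \<open>R\<close> is large.\<close>
  define R where "R = (M\<^sup>2 + y\<^sup>2) / y"
  define s where "s = R - y"
  define q where "q = sqrt (M\<^sup>2 + s\<^sup>2) / R"
  have y: "y > 0" using z by (simp add: y_def)
  have M: "M > 0" by (simp add: M_def)
  have R: "R > 0" using y M by (simp add: R_def add_pos_pos)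
  have Ry: "R * y = M\<^sup>2 + y\<^sup>2" using y by (simp add: R_def)
  have "M\<^sup>2 + s\<^sup>2 < R\<^sup>2"
  proof -
    have "s\<^sup>2 = R\<^sup>2 - 2 * (R * y) + y\<^sup>2" by (simp add: s_def power2_eq_square algebra_simps)
    moreover have "0 < M\<^sup>2" "0 < y\<^sup>2" using y M by auto
    ultimately show ?thesis using Ry by linarith
  qed
  then have q: "q < 1" using R by (simp add: q_def real_less_lsqrt)
  define B where "B u = (\<lambda>k. sym_jacobi \<alpha> u k - (of_real x - \<i> * of_real s) * u k)" for u
  have B: "B u \<in> ell2" "ell2_norm (B u) \<le> q * R * ell2_norm u" if u: "u \<in> ell2" for u
  proof -
    show "B u \<in> ell2" unfolding B_def 
      by (intro ell2_diff(1) ell2_scale u sym_jacobi_ell2(1) \<alpha>)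
    have "ell2_norm (\<lambda>k. sym_jacobi \<alpha> u k - of_real x * u k) \<le> M * ell2_norm u"
      using ell2_diff(2)[OF sym_jacobi_ell2(1)[OF \<alpha> u] ell2_scale[OF u, of "of_real x"]]
        sym_jacobi_ell2(2)[OF \<alpha> u] ell2_norm_scale_le[OF u, of "of_real x"]
      by (simp add: M_def distrib_right)
    then have "(ell2_norm (\<lambda>k. sym_jacobi \<alpha> u k - of_real x * u k))\<^sup>2 \<le> M\<^sup>2 * (ell2_norm u)\<^sup>2"
      by (metis ell2_norm_nonneg power_mono power_mult_distrib)
    then have "(ell2_norm (B u))\<^sup>2 \<le> (M\<^sup>2 + s\<^sup>2) * (ell2_norm u)\<^sup>2"
      unfolding B_def sym_jacobi_pythagoras[OF \<alpha> u] by (simp add: algebra_simps)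
    also have "\<dots> = (q * R * ell2_norm u)\<^sup>2"
      using R by (simp add: q_def power_mult_distrib)
    finally show "ell2_norm (B u) \<le> q * R * ell2_norm u"
      by (rule power2_le_imp_le) (use R in \<open>simp add: q_def\<close>)
  qed
  define T where "T u = (\<lambda>k. 1 / (\<i> * of_real R) * B u k)" for u
  obtain u where u: "u \<in> ell2" "\<And>k. u k = T u k + \<i> / of_real R * f k"
  proof (rule ell2_contraction_equation[of T q "\<lambda>k. \<i> / of_real R * f k"])
    show "T u \<in> ell2" if "u \<in> ell2" for u
      unfolding T_def by (intro ell2_scale B that)
    fix u v assume uv: "u \<in> ell2" "v \<in> ell2"
    have d: "(\<lambda>k. u k - v k) \<in> ell2" by (intro ell2_diff uv)
    have "(\<lambda>k. T u k - T v k) = (\<lambda>k. 1 / (\<i> * of_real R) * B (\<lambda>k. u k - v k) k)"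
      by (simp add: T_def B_def sym_jacobi_diff fun_eq_iff algebra_simps)
    then have "ell2_norm (\<lambda>k. T u k - T v k) \<le> 1 / R * ell2_norm (B (\<lambda>k. u k - v k))"
      using ell2_norm_scale_le[OF B(1)[OF d], of "1 / (\<i> * of_real R)"] R
      by (simp add: norm_divide norm_mult)
    also have "\<dots> \<le> 1 / R * (q * R * ell2_norm (\<lambda>k. u k - v k))"
      using R by (intro mult_left_mono B d) auto
    finally show "ell2_norm (\<lambda>k. T u k - T v k) \<le> q * ell2_norm (\<lambda>k. u k - v k)"
      using R by simp
  qed (use q f ell2_scale[OF f, of "\<i> / of_real R"] in auto)
  have zxy: "z = of_real x + \<i> * of_real (R - s)" by (simp add: complex_eq_iff x_def y_def s_def)
  have "shifted_op (sym_jacobi \<alpha>) z u k = f k" for k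
  proof -
    have "\<i> * of_real R * u k = B u k - f k"
      using R by (subst u(2)) (simp add: T_def algebra_simps)
    then have "B u k - \<i> * of_real R * u k = f k" by (metis add_diff_cancel_left' diff_add_cancel diff_diff_eq2)
    then show ?thesis 
      by (simp add: shifted_op_apply zxy B_def algebra_simps)
  qed
  then show ?thesis using u(1) that by blast
qed

lemma shifted_sym_jacobi_diff:
  "shifted_op (sym_jacobi \<alpha>) z (\<lambda>k. u k - v k) =
     (\<lambda>k. shifted_op (sym_jacobi \<alpha>) z u k - shifted_op (sym_jacobi \<alpha>) z v k)"
  by (simp add: fun_eq_iff shifted_op_apply sym_jacobi_diff algebra_simps)

lemma sym_jacobi_shifted_inj:
  assumes \<alpha>: "\<forall>k. \<bar>\<alpha> k\<bar> \<le> 1" and z: "Im z > 0" and u: "u \<in> ell2" "v \<in> ell2"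
    and eq: "shifted_op (sym_jacobi \<alpha>) z u = shifted_op (sym_jacobi \<alpha>) z v"
  shows "u = v"
proof -
  have "Im z * ell2_norm (\<lambda>k. u k - v k) \<le> 0"
    using sym_jacobi_resolvent_lower_bound[OF \<alpha> ell2_diff(1)[OF u] z]
    by (simp add: shifted_sym_jacobi_diff eq)
  then have "ell2_norm (\<lambda>k. u k - v k) \<le> 0" using z by (simp add: mult_le_0_iff)
  from ell2_norm_eq_0[OF ell2_diff(1)[OF u] this] show ?thesis by (simp add: fun_eq_iff)
qed

lemma sym_jacobi_resolvent:
  assumes \<alpha>: "\<forall>k. \<bar>\<alpha> k\<bar> \<le> 1" and f: "f \<in> ell2" and z: "Im z > 0"
  shows "resolvent (sym_jacobi \<alpha>) z f \<in> ell2"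
    and "shifted_op (sym_jacobi \<alpha>) z (resolvent (sym_jacobi \<alpha>) z f) = f"
    and "ell2_norm (resolvent (sym_jacobi \<alpha>) z f) \<le> ell2_norm f / Im z"
proof -
  obtain u where u: "u \<in> ell2" "shifted_op (sym_jacobi \<alpha>) z u = f"
    using sym_jacobi_resolvent_exists[OF \<alpha> f z] .
  then have im: "f \<in> shifted_op (sym_jacobi \<alpha>) z ` ell2" by auto
  show 1: "resolvent (sym_jacobi \<alpha>) z f \<in> ell2"
    unfolding resolvent_def by (rule inv_into_into[OF im])
  show 2: "shifted_op (sym_jacobi \<alpha>) z (resolvent (sym_jacobi \<alpha>) z f) = f"
    unfolding resolvent_def by (rule f_inv_into_f[OF im])
  show "ell2_norm (resolvent (sym_jacobi \<alpha>) z f) \<le> ell2_norm f / Im z"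
    using sym_jacobi_resolvent_lower_bound[OF \<alpha> 1 z] z unfolding 2 by (simp add: field_simps)
qed

lemma sym_jacobi_resolvent_eqI:
  assumes "\<forall>k. \<bar>\<alpha> k\<bar> \<le> 1" "Im z > 0" "u \<in> ell2" "shifted_op (sym_jacobi \<alpha>) z u = f" "f \<in> ell2"
  shows "resolvent (sym_jacobi \<alpha>) z f = u"
  by (rule sym_jacobi_shifted_inj[OF assms(1,2) sym_jacobi_resolvent(1)[OF assms(1,5,2)] assms(3)])
     (simp_all add: sym_jacobi_resolvent(2)[OF assms(1,5,2)] assms(4))

lemma sym_jacobi_first_resolvent_identity:
  assumes \<alpha>: "\<forall>k. \<bar>\<alpha> k\<bar> \<le> 1" and f: "f \<in> ell2" and z: "Im z > 0" and w: "Im w > 0"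
  defines "R \<equiv> resolvent (sym_jacobi \<alpha>)"
  shows "R z f k = R w f k + (z - w) * R z (R w f) k"
proof -
  note Rw = sym_jacobi_resolvent[OF \<alpha> f w, folded R_def]
  note Rz = sym_jacobi_resolvent[OF \<alpha> Rw(1) z, folded R_def]
  have 1: "sym_jacobi \<alpha> (R w f) j = w * R w f j + f j" for j
    using fun_cong[OF Rw(2), of j] by (simp add: shifted_op_apply algebra_simps)
  have 2: "sym_jacobi \<alpha> (R z (R w f)) j = z * R z (R w f) j + R w f j" for j
    using fun_cong[OF Rz(2), of j] by (simp add: shifted_op_apply algebra_simps)
  have "R z f = (\<lambda>k. R w f k + (z - w) * R z (R w f) k)"
    unfolding R_def
  proof (rule sym_jacobi_resolvent_eqI[OF \<alpha> z _ _ f], fold R_def)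
    show "(\<lambda>k. R w f k + (z - w) * R z (R w f) k) \<in> ell2"
      by (intro ell2_add ell2_scale Rw Rz)
    show "shifted_op (sym_jacobi \<alpha>) z (\<lambda>k. R w f k + (z - w) * R z (R w f) k) = f"
      by (rule ext, simp only: shifted_op_apply sym_jacobi_add sym_jacobi_scale 1 2)
         (simp add: algebra_simps)
  qed
  then show ?thesis by simp
qed

text \<open>By the resolvent identity the difference quotient of \<open>R z f\<close> at \<open>w\<close> is \<open>R z (R w f)\<close>, and a
  second application of the identity, with the norm bound, shows that it converges to
  \<open>R w (R w f)\<close>.\<close>

lemma sym_jacobi_resolvent_holomorphic:
  assumes \<alpha>: "\<forall>k. \<bar>\<alpha> k\<bar> \<le> 1" and f: "f \<in> ell2"
  shows "(\<lambda>z. resolvent (sym_jacobi \<alpha>) z f k) holomorphic_on {z. Im z > 0}"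
proof -
  define R where "R = resolvent (sym_jacobi \<alpha>)"
  note mem = sym_jacobi_resolvent(1)[OF \<alpha>, folded R_def]
  note bound = sym_jacobi_resolvent(3)[OF \<alpha>, folded R_def]
  note ident = sym_jacobi_first_resolvent_identity[OF \<alpha>, folded R_def]
  have open_H: "open {z. Im z > 0}" by (rule open_halfspace_Im_gt)
  have cont: "((\<lambda>z. R z g k) \<longlongrightarrow> R w g k) (at w)" if g: "g \<in> ell2" and w: "Im w > 0" for g w
  proof -
    have "((\<lambda>z. cmod (z - w) * (ell2_norm (R w g) / Im z)) \<longlongrightarrow> cmod (w - w) * (ell2_norm (R w g) / Im w)) (at w)"
      using w by (intro tendsto_intros) auto
    then have lim: "((\<lambda>z. cmod (z - w) * (ell2_norm (R w g) / Im z)) \<longlongrightarrow> 0) (at w)" by simp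
    have "\<forall>\<^sub>F z in at w. Im z > 0"
      using eventually_at_in_open'[OF open_H] w by simp
    then have "\<forall>\<^sub>F z in at w. norm (R z g k - R w g k) \<le> cmod (z - w) * (ell2_norm (R w g) / Im z)"
    proof eventually_elim
      case (elim z)
      have "norm (R z g k - R w g k) = cmod (z - w) * cmod (R z (R w g) k)"
        using ident[OF g elim w, of k] by (simp add: norm_mult)
      also have "\<dots> \<le> cmod (z - w) * (ell2_norm (R w g) / Im z)"
        using norm_le_ell2_norm[OF mem[OF mem[OF g w] elim], of k] bound[OF mem[OF g w] elim]
        by (intro mult_left_mono) auto
      finally show ?case .
    qed
    then have "((\<lambda>z. R z g k - R w g k) \<longlongrightarrow> 0) (at w)"
      by (rule Lim_null_comparison[OF _ lim])
    then show ?thesis by (simp add: LIM_zero_iff)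
  qed
  have "((\<lambda>z. R z f k) has_field_derivative R w (R w f) k) (at w)" if w: "Im w > 0" for w
    unfolding DERIV_def has_field_derivative_iff
  proof (rule Lim_transform_eventually[OF cont[OF mem[OF f w] w]])
    have "\<forall>\<^sub>F z in at w. Im z > 0"
      using eventually_at_in_open'[OF open_H] w by simp
    then show "\<forall>\<^sub>F z in at w. R z (R w f) k = (R z f k - R w f k) / (z - w)"
      using eventually_neq_at_within[of w w UNIV]
    proof eventually_elim
      case (elim z)
      then show ?case using ident[OF f elim(1) w, of k] by simp
    qed
  qed
  then show ?thesis
    unfolding R_def[symmetric] holomorphic_on_def field_differentiable_def
    using has_field_derivative_at_within by blast
qed

section \<open>A decoupled barrier and its sine modes\<close>

text \<open>Off-diagonal entries: the bond between the sites \<open>k\<close> and \<open>k + 1\<close> has weight 1, except that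
  the bonds at \<open>k = 0\<close> and \<open>k = n\<close> are cut. This isolates the block of sites \<open>1, ..., n\<close> from both
  half-lines.\<close>

definition bond :: "nat \<Rightarrow> int \<Rightarrow> real" where
  "bond n k = (if k = 0 \<or> k = int n then 0 else 1)"

text \<open>The diagonal: an imaginary rectangular barrier of height \<open>h\<close> on the block.\<close>

definition barrier :: "nat \<Rightarrow> real \<Rightarrow> int \<Rightarrow> complex" where
  "barrier n h k = (if k \<in> {1..int n} then \<i> * of_real h else 0)"

definition barrier_op :: "nat \<Rightarrow> real \<Rightarrow> seq_op" where
  "barrier_op n h = jacobi (\<lambda>k. of_real (bond n k)) (barrier n h) (\<lambda>k. of_real (bond n k))"

text \<open>The orthogonal projection onto the block.\<close>

definition block :: "nat \<Rightarrow> (int \<Rightarrow> complex) \<Rightarrow> int \<Rightarrow> complex" where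
  "block n u k = (if k \<in> {1..int n} then u k else 0)"

text \<open>The Dirichlet eigenvectors of the block, extended by zero, are the sine modes with
  frequencies \<open>\<pi> j / (n + 1)\<close> for \<open>j = 1, ..., n\<close>.\<close>

definition angle :: "nat \<Rightarrow> nat \<Rightarrow> real" where
  "angle n j = pi * real j / real (n + 1)"

definition mode :: "nat \<Rightarrow> nat \<Rightarrow> int \<Rightarrow> complex" where
  "mode n j k = (if k \<in> {1..int n} then of_real (sin (angle n j * of_int k)) else 0)"

text \<open>The coefficient of \<open>u\<close> along a mode; the modes are not normalised, and each has squared
  norm \<open>(n + 1) / 2\<close>.\<close>

definition coef :: "nat \<Rightarrow> nat \<Rightarrow> (int \<Rightarrow> complex) \<Rightarrow> complex" where
  "coef n j u = 2 / of_nat (n + 1) * (\<Sum>k\<in>{1..int n}. u k * mode n j k)"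

definition barrier_eigenvalue :: "nat \<Rightarrow> real \<Rightarrow> nat \<Rightarrow> complex" where
  "barrier_eigenvalue n h j = of_real (2 * cos (angle n j)) + \<i> * of_real h"

lemma bond_le_1: "\<forall>k. \<bar>bond n k\<bar> \<le> 1"
  by (simp add: bond_def)

lemma barrier_op_apply: "barrier_op n h u k = sym_jacobi (bond n) u k + \<i> * of_real h * block n u k"
  by (simp add: barrier_op_def sym_jacobi_apply jacobi_def barrier_def block_def)

lemma sym_jacobi_block: "sym_jacobi (bond n) (block n u) k = block n (sym_jacobi (bond n) u) k"
  by (auto simp: sym_jacobi_apply bond_def block_def)

text \<open>At the ends of the block the cut bond does the same as the vanishing of the sine at the sites
  \<open>0\<close> and \<open>n + 1\<close>.\<close>

lemma mode_eigen: "sym_jacobi (bond n) (mode n j) k = of_real (2 * cos (angle n j)) * mode n j k"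
proof (cases "k \<in> {1..int n}")
  case True
  have right_end: "sin (angle n j * of_int (int n + 1)) = 0"
  proof -
    have "angle n j * of_int (int n + 1) = pi * real j" by (simp add: angle_def field_simps)
    then show ?thesis by (simp only: sin_npi2)
  qed
  have lo: "of_real (bond n (k - 1)) * mode n j (k - 1) = of_real (sin (angle n j * of_int (k - 1)))"
    using True by (cases "k = 1") (auto simp: bond_def mode_def)
  have hi: "of_real (bond n k) * mode n j (k + 1) = of_real (sin (angle n j * of_int (k + 1)))"
    using True right_end by (cases "k = int n") (auto simp: bond_def mode_def)
  have "sin (angle n j * of_int (k - 1)) + sin (angle n j * of_int (k + 1)) 
          = 2 * cos (angle n j) * sin (angle n j * of_int k)"
    by (simp add: algebra_simps sin_add sin_diff)
  then show ?thesis
    using True unfolding sym_jacobi_apply lo hi by (simp add: mode_def flip: of_real_add)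
next
  case False
  then show ?thesis by (auto simp: sym_jacobi_apply bond_def mode_def)
qed

lemma sum_telescope_int:
  fixes V :: "int \<Rightarrow> 'a::ab_group_add"
  shows "(\<Sum>k\<in>{1..int n}. V k - V (k - 1)) = V (int n) - V 0"
proof (induction n)
  case (Suc n)
  have "{1..int (Suc n)} = insert (int (Suc n)) {1..int n}" by auto
  then show ?case using Suc by simp
qed simp

text \<open>Symmetry of the operator against a mode, by summation by parts. The boundary terms carry the
  weights of the cut bonds, so nothing is required of \<open>u\<close>.\<close>

lemma sym_jacobi_mode_sum:
  "(\<Sum>k\<in>{1..int n}. sym_jacobi (bond n) u k * mode n j k) =
     of_real (2 * cos (angle n j)) * (\<Sum>k\<in>{1..int n}. u k * mode n j k)"
proof -
  \<comment> \<open>The discrete Wronskian of \<open>u\<close> and the mode, weighted by the bonds.\<close>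
  define V where "V k = of_real (bond n k) * (u (k + 1) * mode n j k - u k * mode n j (k + 1))" for k
  have "sym_jacobi (bond n) u k * mode n j k - of_real (2 * cos (angle n j)) * (u k * mode n j k) = V k - V (k - 1)"
    for k
  proof -
    have "sym_jacobi (bond n) u k * mode n j k - of_real (2 * cos (angle n j)) * (u k * mode n j k)
       = sym_jacobi (bond n) u k * mode n j k - u k * sym_jacobi (bond n) (mode n j) k"
      by (simp add: mode_eigen)
    then show ?thesis by (simp add: V_def sym_jacobi_apply algebra_simps)
  qed
  then have "(\<Sum>k\<in>{1..int n}. sym_jacobi (bond n) u k * mode n j k
         - of_real (2 * cos (angle n j)) * (u k * mode n j k)) = V (int n) - V 0"
    by (simp only: sum_telescope_int)
  also have "\<dots> = 0" by (simp add: V_def bond_def)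
  finally show ?thesis by (simp add: sum_subtractf sum_distrib_left)
qed

lemma angle_bounds: "j \<in> {1..n} \<Longrightarrow> 0 < angle n j \<and> angle n j < pi"
  using mult_strict_left_mono[OF _ pi_gt_zero, of "real j" "real (n + 1)"]
  by (auto simp: angle_def field_simps)

lemma cos_angle_inj:
  assumes "i \<in> {1..n}" "j \<in> {1..n}" "cos (angle n i) = cos (angle n j)"
  shows "i = j"
proof -
  have "angle n i = angle n j"
    using angle_bounds[OF assms(1)] angle_bounds[OF assms(2)] assms(3) cos_inj_pi by force
  then show ?thesis by (simp add: angle_def)
qed

text \<open>Multiplied by \<open>4 sin \<theta>\<close>, the squares of the sines sum up by telescoping.\<close>

lemma mode_norm:
  assumes "j \<in> {1..n}"
  shows "(\<Sum>k\<in>{1..int n}. mode n j k * mode n j k) = of_nat (n + 1) / 2"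
proof -
  define \<theta> where "\<theta> = angle n j"
  have s: "sin \<theta> > 0" using angle_bounds[OF assms] by (simp add: \<theta>_def sin_gt_zero)
  have right_end: "sin (\<theta> * (2 * of_int (int n) + 1)) = - sin \<theta>"
  proof -
    have "\<theta> * (2 * of_int (int n) + 1) = 2 * real j * pi - \<theta>"
      by (simp add: \<theta>_def angle_def field_simps)
    then show ?thesis by (simp only: sin_diff sin_2npi cos_2npi)
  qed
  have "4 * sin \<theta> * (sin (\<theta> * of_int k))\<^sup>2
      = 2 * sin \<theta> - (sin (\<theta> * (2 * of_int k + 1)) - sin (\<theta> * (2 * of_int (k - 1) + 1)))" for k
  proof -
    have 1: "\<theta> * (2 * of_int k + 1) = 2 * (\<theta> * of_int k) + \<theta>" 
      "\<theta> * (2 * of_int (k - 1) + 1) = 2 * (\<theta> * of_int k) - \<theta>" by (simp_all add: algebra_simps)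
    show ?thesis unfolding 1 sin_add sin_diff cos_double_sin by (simp add: algebra_simps)
  qed
  then have "4 * sin \<theta> * (\<Sum>k\<in>{1..int n}. (sin (\<theta> * of_int k))\<^sup>2) =
     (\<Sum>k\<in>{1..int n}. 2 * sin \<theta> - (sin (\<theta> * (2 * of_int k + 1)) - sin (\<theta> * (2 * of_int (k - 1) + 1))))"
    by (simp only: sum_distrib_left)
  also have "\<dots> = 2 * real n * sin \<theta> - (sin (\<theta> * (2 * of_int (int n) + 1)) - sin (\<theta> * (2 * of_int 0 + 1)))"
    unfolding sum_subtractf[of "\<lambda>k. 2 * sin \<theta>"]
    by (subst sum_telescope_int[of "\<lambda>k. sin (\<theta> * (2 * of_int k + 1))"]) simp
  also have "\<dots> = 4 * sin \<theta> * (real (n + 1) / 2)" unfolding right_end by (simp add: algebra_simps)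
  finally have "(\<Sum>k\<in>{1..int n}. (sin (\<theta> * of_int k))\<^sup>2) = real (n + 1) / 2" using s by simp
  moreover have "(\<Sum>k\<in>{1..int n}. mode n j k * mode n j k) 
      = of_real (\<Sum>k\<in>{1..int n}. (sin (\<theta> * of_int k))\<^sup>2)"
    unfolding of_real_sum by (intro sum.cong) (auto simp: mode_def \<theta>_def power2_eq_square)
  ultimately show ?thesis by (simp only:) simp
qed

lemma mode_orthogonal:
  assumes "i \<in> {1..n}" "j \<in> {1..n}"
  shows "(\<Sum>k\<in>{1..int n}. mode n i k * mode n j k) = (if i = j then of_nat (n + 1) / 2 else 0)"
proof (cases "i = j")
  case False
  have "of_real (2 * cos (angle n i)) * (\<Sum>k\<in>{1..int n}. mode n i k * mode n j k) =
        of_real (2 * cos (angle n j)) * (\<Sum>k\<in>{1..int n}. mode n i k * mode n j k)"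
    using sym_jacobi_mode_sum[of n "mode n i" j] by (simp add: mode_eigen sum_distrib_left mult.assoc)
  moreover have "of_real (2 * cos (angle n i)) \<noteq> (of_real (2 * cos (angle n j)) :: complex)"
    using cos_angle_inj[OF assms] False unfolding of_real_eq_iff by force
  ultimately show ?thesis using False by simp
qed (use mode_norm[OF assms(1)] in simp)

text \<open>Since \<open>mode n j k\<close> is symmetric in \<open>j\<close> and \<open>k\<close>, orthogonality of the modes is also their
  completeness in the block.\<close>

lemma mode_complete: "(\<Sum>j\<in>{1..n}. coef n j u * mode n j k) = block n u k"
proof (cases "k \<in> {1..int n}")
  case True
  have dual: "(\<Sum>j\<in>{1..n}. mode n j l * mode n j k) = (if l = k then of_nat (n + 1) / 2 else 0)"
    if l: "l \<in> {1..int n}" for l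
  proof -
    have swap: "mode n j m = mode n (nat m) (int j)" if "j \<in> {1..n}" "m \<in> {1..int n}" for j m
      using that by (auto simp: mode_def angle_def field_simps)
    have "(\<Sum>j\<in>{1..n}. mode n j l * mode n j k)
        = (\<Sum>j\<in>{1..n}. mode n (nat l) (int j) * mode n (nat k) (int j))"
      using l True by (intro sum.cong) (simp_all add: swap[of _ l] swap[of _ k])
    also have "\<dots> = (\<Sum>m\<in>int ` {1..n}. mode n (nat l) m * mode n (nat k) m)"
      by (subst sum.reindex) (auto simp: inj_on_def)
    also have "int ` {1..n} = {1..int n}" by (simp add: image_int_atLeastAtMost)
    also have "(\<Sum>m\<in>{1..int n}. mode n (nat l) m * mode n (nat k) m)
        = (if nat l = nat k then of_nat (n + 1) / 2 else 0)"
      using l True by (intro mode_orthogonal) auto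
    finally show ?thesis using l True by (auto simp: eq_nat_nat_iff)
  qed
  have "(\<Sum>j\<in>{1..n}. coef n j u * mode n j k)
      = (\<Sum>j\<in>{1..n}. \<Sum>l\<in>{1..int n}. 2 / of_nat (n + 1) * u l * (mode n j l * mode n j k))"
    by (simp add: coef_def sum_distrib_left sum_distrib_right mult_ac)
  also have "\<dots> = (\<Sum>l\<in>{1..int n}. 2 / of_nat (n + 1) * u l * (\<Sum>j\<in>{1..n}. mode n j l * mode n j k))"
    by (subst sum.swap) (simp add: sum_distrib_left)
  also have "\<dots> = (\<Sum>l\<in>{1..int n}. if l = k then u l else 0)"
    by (intro sum.cong refl, subst dual) (auto simp: field_simps simp del: of_nat_Suc)
  also have "\<dots> = u k" using True by simp
  finally show ?thesis using True by (simp add: block_def)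
next
  case False
  then show ?thesis by (auto simp: mode_def block_def)
qed

lemma coef_mode: "j \<in> {1..n} \<Longrightarrow> coef n j (mode n j) = 1"
  unfolding coef_def mode_orthogonal by (simp del: of_nat_Suc of_nat_add)

lemma mode_ell2: "mode n j \<in> ell2"
  by (rule ell2_finite_support[of "{1..int n}"]) (auto simp: mode_def)

lemma mode_nonzero: "j \<in> {1..n} \<Longrightarrow> mode n j \<noteq> (\<lambda>k. 0)"
  using coef_mode[of j n] by (auto simp: coef_def)

lemma block_ell2: "u \<in> ell2 \<Longrightarrow> block n u \<in> ell2"
  by (rule ell2_finite_support[of "{1..int n}"]) (auto simp: block_def)

lemma off_block_ell2:
  assumes "u \<in> ell2"
  shows "(\<lambda>k. u k - block n u k) \<in> ell2" "ell2_norm (\<lambda>k. u k - block n u k) \<le> ell2_norm u"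
proof -
  have eq: "(\<lambda>k. u k - block n u k) = (\<lambda>k. (if k \<in> {1..int n} then 0 else 1) * u k)"
    by (auto simp: block_def)
  show "(\<lambda>k. u k - block n u k) \<in> ell2" by (intro ell2_diff block_ell2 assms)
  show "ell2_norm (\<lambda>k. u k - block n u k) \<le> ell2_norm u"
    unfolding eq using ell2_mult_bounded(2)[OF assms, of "\<lambda>k. if k \<in> {1..int n} then 0 else 1" 1] by simp
qed

lemma coef_bound:
  assumes "u \<in> ell2"
  shows "cmod (coef n j u) \<le> 2 * ell2_norm u"
proof -
  have "cmod (\<Sum>k\<in>{1..int n}. u k * mode n j k) \<le> (\<Sum>k\<in>{1..int n}. ell2_norm u)"
  proof (rule sum_norm_le)
    fix k
    have "cmod (u k) * cmod (mode n j k) \<le> ell2_norm u * 1"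
      by (intro mult_mono norm_le_ell2_norm assms) (auto simp: mode_def)
    then show "cmod (u k * mode n j k) \<le> ell2_norm u" by (simp add: norm_mult)
  qed
  also have "\<dots> \<le> real (n + 1) * ell2_norm u" by (simp add: mult_right_mono)
  finally have "cmod (coef n j u) \<le> 2 / real (n + 1) * (real (n + 1) * ell2_norm u)"
    unfolding coef_def norm_mult norm_divide norm_of_nat norm_numeral
    by (intro mult_left_mono) auto
  also have "\<dots> = 2 * ell2_norm u" by (simp del: of_nat_add of_nat_Suc)
  finally show ?thesis .
qed

section \<open>Spectrum and Riesz projections of the barrier operator\<close>

text \<open>The resolvent splits into the free one off the block and the eigenfunction expansion on it.\<close>

definition barrier_resolvent :: "nat \<Rightarrow> real \<Rightarrow> complex \<Rightarrow> seq_op" where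
  "barrier_resolvent n h z f k =
     resolvent (sym_jacobi (bond n)) z (\<lambda>k. f k - block n f k) k +
     (\<Sum>j\<in>{1..n}. coef n j f / (barrier_eigenvalue n h j - z) * mode n j k)"

lemma barrier_op_mode:
  "barrier_op n h (mode n j) k = barrier_eigenvalue n h j * mode n j k"
proof -
  have "block n (mode n j) k = mode n j k" by (simp add: block_def mode_def)
  then show ?thesis
    by (simp add: barrier_op_apply mode_eigen barrier_eigenvalue_def algebra_simps)
qed

lemma barrier_op_diff: "barrier_op n h (\<lambda>k. u k - v k) k = barrier_op n h u k - barrier_op n h v k"
  and barrier_op_add: "barrier_op n h (\<lambda>k. u k + v k) k = barrier_op n h u k + barrier_op n h v k"
  by (simp_all add: barrier_op_def jacobi_def algebra_simps)

lemma barrier_op_zero: "barrier_op n h (\<lambda>k. 0) k = 0"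
  by (simp add: barrier_op_def jacobi_def)

lemma barrier_op_sum:
  "barrier_op n h (\<lambda>k. \<Sum>j\<in>S. c j * u j k) k = (\<Sum>j\<in>S. c j * barrier_op n h (u j) k)"
  by (simp add: barrier_op_def jacobi_def sum_distrib_left sum.distrib algebra_simps)

lemma barrier_op_ell2: "u \<in> ell2 \<Longrightarrow> barrier_op n h u \<in> ell2"
proof -
  assume u: "u \<in> ell2"
  have "(\<lambda>k. sym_jacobi (bond n) u k + \<i> * of_real h * block n u k) \<in> ell2"
    by (intro ell2_add ell2_scale block_ell2 u sym_jacobi_ell2 bond_le_1)
  then show ?thesis by (simp add: barrier_op_apply[symmetric])
qed

lemma sym_jacobi_kernel:
  assumes "Im z > 0" "u \<in> ell2" "\<And>k. sym_jacobi (bond n) u k = z * u k"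
  shows "u = (\<lambda>k. 0)"
proof (rule sym_jacobi_shifted_inj[OF bond_le_1 assms(1,2)])
  show "shifted_op (sym_jacobi (bond n)) z u = shifted_op (sym_jacobi (bond n)) z (\<lambda>k. 0)"
    by (rule ext) (simp add: shifted_op_apply assms(3) sym_jacobi_apply[of _ "\<lambda>k. 0"])
qed simp

lemma barrier_resolvent_ell2:
  assumes "Im z > 0" "f \<in> ell2"
  shows "barrier_resolvent n h z f \<in> ell2"
proof -
  have "(\<lambda>k. barrier_resolvent n h z f k) \<in> ell2"
    unfolding barrier_resolvent_def using assms
    by (intro ell2_add ell2_sum ell2_scale mode_ell2 sym_jacobi_resolvent bond_le_1 off_block_ell2) auto
  then show ?thesis .
qed

lemma barrier_resolvent_solves:
  assumes z: "Im z > 0" and ne: "\<forall>j\<in>{1..n}. z \<noteq> barrier_eigenvalue n h j" and f: "f \<in> ell2"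
  shows "shifted_op (barrier_op n h) z (barrier_resolvent n h z f) = f"
proof
  fix k
  define w where "w = resolvent (sym_jacobi (bond n)) z (\<lambda>k. f k - block n f k)"
  define c where "c j = coef n j f / (barrier_eigenvalue n h j - z)" for j
  note w = sym_jacobi_resolvent[OF bond_le_1[of n] off_block_ell2(1)[OF f, of n] z, folded w_def]
  have Aw: "sym_jacobi (bond n) w k = z * w k + f k - block n f k" for k
    using fun_cong[OF w(2), of k] by (simp add: shifted_op_apply algebra_simps)
  have "block n w = (\<lambda>k. 0)"
  proof (rule sym_jacobi_kernel[OF z block_ell2[OF w(1)]])
    show "sym_jacobi (bond n) (block n w) k = z * block n w k" for k
      unfolding sym_jacobi_block by (simp add: block_def Aw)
  qed
  then have Jw: "barrier_op n h w k = z * w k + f k - block n f k"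
    by (simp add: barrier_op_apply Aw)
  have "shifted_op (barrier_op n h) z (barrier_resolvent n h z f) k
      = barrier_op n h w k - z * w k + (\<Sum>j\<in>{1..n}. c j * (barrier_eigenvalue n h j - z) * mode n j k)"
  proof -
    have eq: "barrier_resolvent n h z f = (\<lambda>k. w k + (\<Sum>j\<in>{1..n}. c j * mode n j k))"
      by (simp add: fun_eq_iff barrier_resolvent_def w_def c_def)
    show ?thesis
      unfolding eq shifted_op_apply barrier_op_add barrier_op_sum barrier_op_mode
      by (simp add: algebra_simps sum_distrib_left sum_subtractf)
  qed
  also have "(\<Sum>j\<in>{1..n}. c j * (barrier_eigenvalue n h j - z) * mode n j k)
      = (\<Sum>j\<in>{1..n}. coef n j f * mode n j k)"
    by (intro sum.cong refl) (use ne in \<open>force simp: c_def\<close>)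
  also have "\<dots> = block n f k" by (rule mode_complete)
  finally show "shifted_op (barrier_op n h) z (barrier_resolvent n h z f) k = f k"
    by (simp add: Jw)
qed

lemma barrier_op_kernel:
  assumes z: "Im z > 0" and ne: "\<forall>j\<in>{1..n}. z \<noteq> barrier_eigenvalue n h j"
    and u: "u \<in> ell2" and eq: "\<And>k. barrier_op n h u k = z * u k"
  shows "u = (\<lambda>k. 0)"
proof -
  have "(\<lambda>k. u k - block n u k) = (\<lambda>k. 0)"
  proof (rule sym_jacobi_kernel[OF z off_block_ell2(1)[OF u]])
    show "sym_jacobi (bond n) (\<lambda>k. u k - block n u k) k = z * (u k - block n u k)" for k
      using eq[of k] unfolding sym_jacobi_diff sym_jacobi_block
      by (auto simp: barrier_op_apply block_def)
  qed
  then have ub: "u k = block n u k" for k by (metis eq_iff_diff_eq_0)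
  have "coef n j u = 0" if j: "j \<in> {1..n}" for j
  proof -
    define s where "s = (\<Sum>k\<in>{1..int n}. u k * mode n j k)"
    have "z * s = (\<Sum>k\<in>{1..int n}. barrier_op n h u k * mode n j k)"
      by (simp add: s_def eq sum_distrib_left mult.assoc)
    also have "\<dots> = (\<Sum>k\<in>{1..int n}. sym_jacobi (bond n) u k * mode n j k) + \<i> * of_real h * s"
      by (simp add: s_def barrier_op_apply ub[symmetric] sum_distrib_left sum.distrib algebra_simps)
    also have "\<dots> = barrier_eigenvalue n h j * s"
      unfolding sym_jacobi_mode_sum by (simp add: s_def barrier_eigenvalue_def distrib_right)
    finally have "s = 0" using ne j by fastforce
    then show ?thesis by (simp add: coef_def s_def)
  qed
  then have "block n u k = 0" for k using mode_complete[of n u k] by simp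
  then show ?thesis using ub by (simp add: fun_eq_iff)
qed

lemma barrier_resolvent_bounded:
  assumes z: "Im z > 0"
  shows "\<exists>K. \<forall>f\<in>ell2. ell2_norm (barrier_resolvent n h z f) \<le> K * ell2_norm f"
proof (intro exI ballI)
  fix f :: "int \<Rightarrow> complex" assume f: "f \<in> ell2"
  define r where "r j = 2 / cmod (barrier_eigenvalue n h j - z) * ell2_norm (mode n j)" for j
  define w where "w = resolvent (sym_jacobi (bond n)) z (\<lambda>k. f k - block n f k)"
  define c where "c j = coef n j f / (barrier_eigenvalue n h j - z)" for j
  note w = sym_jacobi_resolvent[OF bond_le_1[of n] off_block_ell2(1)[OF f, of n] z, folded w_def]
  have eq: "barrier_resolvent n h z f = (\<lambda>k. w k + (\<Sum>j\<in>{1..n}. c j * mode n j k))"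
    by (simp add: fun_eq_iff barrier_resolvent_def w_def c_def)
  have s: "(\<lambda>k. \<Sum>j\<in>{1..n}. c j * mode n j k) \<in> ell2"
    by (intro ell2_sum ell2_scale mode_ell2) auto
  have "ell2_norm (barrier_resolvent n h z f) \<le> 
      ell2_norm w + ell2_norm (\<lambda>k. \<Sum>j\<in>{1..n}. c j * mode n j k)"
    unfolding eq by (rule ell2_add(2)[OF w(1) s])
  also have "ell2_norm w \<le> 1 / Im z * ell2_norm f"
    using w(3) off_block_ell2(2)[OF f, of n] z by (simp add: field_simps)
  also have "ell2_norm (\<lambda>k. \<Sum>j\<in>{1..n}. c j * mode n j k) \<le> (\<Sum>j\<in>{1..n}. ell2_norm (\<lambda>k. c j * mode n j k))"
    by (intro ell2_sum ell2_scale mode_ell2) auto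
  also have "\<dots> \<le> (\<Sum>j\<in>{1..n}. r j * ell2_norm f)"
  proof (rule sum_mono)
    fix j
    have "cmod (c j) \<le> 2 * ell2_norm f / cmod (barrier_eigenvalue n h j - z)"
      unfolding c_def norm_divide by (intro divide_right_mono coef_bound f) auto
    then have "cmod (c j) * ell2_norm (mode n j) 
        \<le> 2 * ell2_norm f / cmod (barrier_eigenvalue n h j - z) * ell2_norm (mode n j)"
      by (intro mult_right_mono) auto
    then show "ell2_norm (\<lambda>k. c j * mode n j k) \<le> r j * ell2_norm f"
      using ell2_norm_scale_le[OF mode_ell2, of "c j" n j] by (simp add: r_def mult_ac)
  qed
  finally show "ell2_norm (barrier_resolvent n h z f) \<le> (1 / Im z + (\<Sum>j\<in>{1..n}. r j)) * ell2_norm f"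
    by (simp add: distrib_right sum_distrib_right)
qed

lemma barrier_resolvent_correct:
  assumes z: "Im z > 0" and ne: "\<forall>j\<in>{1..n}. z \<noteq> barrier_eigenvalue n h j"
  shows "z \<in> resolvent_set (barrier_op n h)"
    and "\<And>f. f \<in> ell2 \<Longrightarrow> resolvent (barrier_op n h) z f = barrier_resolvent n h z f"
proof -
  have inj: "inj_on (shifted_op (barrier_op n h) z) ell2"
  proof (rule inj_onI)
    fix u v assume uv: "u \<in> ell2" "v \<in> ell2"
      and eq: "shifted_op (barrier_op n h) z u = shifted_op (barrier_op n h) z v"
    have "(\<lambda>k. u k - v k) = (\<lambda>k. 0)"
    proof (rule barrier_op_kernel[OF z ne ell2_diff(1)[OF uv]])
      show "barrier_op n h (\<lambda>k. u k - v k) k = z * (u k - v k)" for k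
        using fun_cong[OF eq, of k] by (simp add: shifted_op_apply barrier_op_diff algebra_simps)
    qed
    then show "u = v" by (simp add: fun_eq_iff)
  qed
  show res: "resolvent (barrier_op n h) z f = barrier_resolvent n h z f" if "f \<in> ell2" for f
    unfolding resolvent_def
    by (rule inv_into_f_eq[OF inj])
       (rule barrier_resolvent_ell2[OF z that] barrier_resolvent_solves[OF z ne that])+
  have "shifted_op (barrier_op n h) z ` ell2 = ell2"
  proof
    have "shifted_op (barrier_op n h) z u \<in> ell2" if "u \<in> ell2" for u
    proof -
      have "(\<lambda>k. barrier_op n h u k - z * u k) \<in> ell2"
        by (intro ell2_diff ell2_scale barrier_op_ell2 that)
      then show ?thesis by (simp add: shifted_op_apply[symmetric])
    qed
    then show "shifted_op (barrier_op n h) z ` ell2 \<subseteq> ell2" by blast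
    show "ell2 \<subseteq> shifted_op (barrier_op n h) z ` ell2"
      using barrier_resolvent_solves[OF z ne] barrier_resolvent_ell2[OF z] by (metis image_eqI subsetI)
  qed
  with inj have "bij_betw (shifted_op (barrier_op n h) z) ell2 ell2" by (simp add: bij_betw_def)
  moreover have "\<exists>K. \<forall>f\<in>ell2. ell2_norm (resolvent (barrier_op n h) z f) \<le> K * ell2_norm f"
    using barrier_resolvent_bounded[OF z, of n h] by (simp add: res)
  ultimately show "z \<in> resolvent_set (barrier_op n h)" by (simp add: resolvent_set_def)
qed

lemma barrier_eigenvalue_inj:
  "i \<in> {1..n} \<Longrightarrow> j \<in> {1..n} \<Longrightarrow> barrier_eigenvalue n h i = barrier_eigenvalue n h j \<Longrightarrow> i = j"
  by (rule cos_angle_inj, assumption+) (drule arg_cong[of _ _ Re], simp add: barrier_eigenvalue_def)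

text \<open>A neighbourhood of one eigenvalue that avoids the other ones and the real axis.\<close>

definition eigen_nhd :: "nat \<Rightarrow> real \<Rightarrow> nat \<Rightarrow> complex set" where
  "eigen_nhd n h j = {z. Im z > 0} - barrier_eigenvalue n h ` ({1..n} - {j})"

lemma open_eigen_nhd: "open (eigen_nhd n h j)"
  unfolding eigen_nhd_def by (intro open_Diff open_halfspace_Im_gt finite_imp_closed) auto

lemma barrier_eigenvalue_in_nhd:
  assumes "h > 0" "j \<in> {1..n}"
  shows "barrier_eigenvalue n h j \<in> eigen_nhd n h j"
proof -
  have "Im (barrier_eigenvalue n h j) > 0" using assms(1) by (simp add: barrier_eigenvalue_def)
  moreover have "barrier_eigenvalue n h j \<notin> barrier_eigenvalue n h ` ({1..n} - {j})"
    using barrier_eigenvalue_inj[OF assms(2)] by fastforce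
  ultimately show ?thesis by (simp add: eigen_nhd_def)
qed

lemma eigen_nhd_regular:
  "z \<in> eigen_nhd n h j \<Longrightarrow> z \<noteq> barrier_eigenvalue n h j \<Longrightarrow>
    \<forall>i\<in>{1..n}. z \<noteq> barrier_eigenvalue n h i"
  by (auto simp: eigen_nhd_def)

text \<open>Near an eigenvalue every term of \<open>barrier_resolvent\<close> is holomorphic except one, which has a
  simple pole; the Riesz projection is therefore the projection onto the mode.\<close>

lemma riesz_proj_barrier:
  assumes h: "h > 0" and j: "j \<in> {1..n}" and f: "f \<in> ell2"
  shows "riesz_proj (barrier_op n h) (barrier_eigenvalue n h j) f = scale_seq (coef n j f) (mode n j)"
proof
  fix k
  let ?w = "barrier_eigenvalue n h j" and ?T = "eigen_nhd n h j"
  \<comment> \<open>The part of the resolvent that is holomorphic at the eigenvalue.\<close>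
  define reg where "reg z = resolvent (sym_jacobi (bond n)) z (\<lambda>k. f k - block n f k) k +
     (\<Sum>i\<in>{1..n} - {j}. coef n i f / (barrier_eigenvalue n h i - z) * mode n i k)" for z
  define num where "num z = reg z * (z - ?w) - coef n j f * mode n j k" for z
  have split: "barrier_resolvent n h z f k = num z / (z - ?w)" if "z \<noteq> ?w" for z
  proof -
    have "barrier_resolvent n h z f k = reg z + coef n j f / (?w - z) * mode n j k"
      unfolding barrier_resolvent_def reg_def using j by (subst sum.remove[of _ j]) auto
    then show ?thesis using that by (simp add: num_def field_simps)
  qed
  have "reg holomorphic_on ?T"
    unfolding reg_def
  proof (intro holomorphic_intros)
    show "(\<lambda>z. resolvent (sym_jacobi (bond n)) z (\<lambda>k. f k - block n f k) k) holomorphic_on ?T"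
      by (rule holomorphic_on_subset[OF sym_jacobi_resolvent_holomorphic[OF bond_le_1 off_block_ell2(1)[OF f]]])
         (auto simp: eigen_nhd_def)
  qed (auto simp: eigen_nhd_def)
  then have "num holomorphic_on ?T" unfolding num_def by (intro holomorphic_intros)
  then have res: "residue (\<lambda>z. num z / (z - ?w)) ?w = num ?w"
    by (rule residue_simple[OF open_eigen_nhd barrier_eigenvalue_in_nhd[OF h j]])
  have "\<forall>\<^sub>F z in at ?w. z \<in> ?T"
    by (rule eventually_at_in_open'[OF open_eigen_nhd barrier_eigenvalue_in_nhd[OF h j]])
  then have "\<forall>\<^sub>F z in at ?w. resolvent (barrier_op n h) z f k = num z / (z - ?w)"
    using eventually_neq_at_within[of ?w ?w UNIV]
  proof eventually_elim
    case (elim z)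
    then have "Im z > 0" by (simp add: eigen_nhd_def)
    from barrier_resolvent_correct(2)[OF this eigen_nhd_regular[OF elim] f]
    show ?case using split[OF elim(2)] by simp
  qed
  then have "residue (\<lambda>z. resolvent (barrier_op n h) z f k) ?w = num ?w"
    using residue_cong[OF _ refl] res by metis
  then show "riesz_proj (barrier_op n h) ?w f k = scale_seq (coef n j f) (mode n j) k"
    by (simp add: riesz_proj_def num_def scale_seq_def)
qed

lemma barrier_eigenvalue_discrete:
  assumes h: "h > 0" and j: "j \<in> {1..n}"
  shows "barrier_eigenvalue n h j \<in> discrete_spectrum (barrier_op n h)"
    and "alg_mult (barrier_op n h) (barrier_eigenvalue n h j) = 1"
proof -
  let ?J = "barrier_op n h" and ?w = "barrier_eigenvalue n h j"
  have nz: "mode n j \<noteq> 0" using mode_nonzero[OF j] by (simp add: zero_fun_def)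
  have img: "riesz_proj ?J ?w ` ell2 \<subseteq> cseq.span {mode n j}"
    using riesz_proj_barrier[OF h j] by (auto intro: cseq.span_scale cseq.span_base)
  have "riesz_proj ?J ?w (mode n j) = mode n j"
    using riesz_proj_barrier[OF h j mode_ell2] coef_mode[OF j] by (simp add: scale_seq_def)
  then have "mode n j \<in> riesz_proj ?J ?w ` ell2" 
    by (intro image_eqI[of _ _ "mode n j"] mode_ell2) simp
  then have span: "cseq.span {mode n j} = cseq.span (riesz_proj ?J ?w ` ell2)"
    by (intro subset_antisym cseq.span_mono cseq.span_minimal[OF img] cseq.subspace_span) simp
  have "cseq.independent {mode n j}" using nz by simp
  from cseq.dim_eq_card[OF span this] show "alg_mult ?J ?w = 1" by (simp add: alg_mult_def)
  have fin: "finite_alg_mult ?J ?w" unfolding finite_alg_mult_def using img by blast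
  have eig: "?J (mode n j) = scale_seq ?w (mode n j)"
    by (simp add: fun_eq_iff barrier_op_mode scale_seq_def)
  then have ev: "eigenvalue ?J ?w" unfolding eigenvalue_def using nz mode_ell2 by blast
  have "\<not> inj_on (shifted_op ?J ?w) ell2"
  proof
    assume "inj_on (shifted_op ?J ?w) ell2"
    moreover have "shifted_op ?J ?w (mode n j) = shifted_op ?J ?w (\<lambda>k. 0)"
      by (rule ext) (simp add: shifted_op_apply barrier_op_mode barrier_op_zero)
    ultimately have "mode n j = (\<lambda>k. 0)" using mode_ell2 ell2_zero(1) by (meson inj_onD)
    then show False using mode_nonzero[OF j] by simp
  qed
  then have spec: "?w \<in> spectrum ?J" by (auto simp: spectrum_def resolvent_set_def bij_betw_def)
  have "eigen_nhd n h j \<inter> spectrum ?J = {?w}"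
  proof
    show "eigen_nhd n h j \<inter> spectrum ?J \<subseteq> {?w}"
    proof
      fix z assume z: "z \<in> eigen_nhd n h j \<inter> spectrum ?J"
      then have "Im z > 0" by (simp add: eigen_nhd_def)
      from barrier_resolvent_correct(1)[OF this, of n h] z eigen_nhd_regular[of z n h j]
      show "z \<in> {?w}" by (auto simp: spectrum_def)
    qed
    show "{?w} \<subseteq> eigen_nhd n h j \<inter> spectrum ?J" using spec barrier_eigenvalue_in_nhd[OF h j] by simp
  qed
  then have "?w isolated_in spectrum ?J"
    unfolding isolated_in_def using spec open_eigen_nhd by blast
  then show "?w \<in> discrete_spectrum ?J" using ev fin by (simp add: discrete_spectrum_def)
qed

section \<open>Divergence of the Lieb--Thirring quotient\<close>

text \<open>The sequence associated with the barrier operator. For \<open>0 \<le> h \<le> 1\<close> it equals \<open>h\<close> inside the block and 0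
  outside, apart from at most four sites next to the cut bonds, where it equals 1.\<close>

definition barrier_seq :: "nat \<Rightarrow> real \<Rightarrow> int \<Rightarrow> real" where
  "barrier_seq n h = jacobi_seq (\<lambda>k. of_real (bond n k)) (barrier n h) (\<lambda>k. of_real (bond n k))"

lemma barrier_seq_bounds:
  assumes h: "0 \<le> h" "h \<le> 1"
  shows "0 \<le> barrier_seq n h k"
    and "barrier_seq n h k \<le> 1"
    and "k \<notin> {0, 1, int n, int n + 1} \<Longrightarrow> barrier_seq n h k \<le> (if k \<in> {1..int n} then h else 0)"
proof -
  have eq: "barrier_seq n h k = Max {\<bar>bond n (k - 1) - 1\<bar>, \<bar>bond n k - 1\<bar>, cmod (barrier n h k)}"
  proof -
    have "cmod (of_real x - 1) = \<bar>x - 1\<bar>" for x :: real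
      by (metis norm_of_real of_real_1 of_real_diff)
    then show ?thesis unfolding barrier_seq_def jacobi_seq_def by (intro arg_cong[of _ _ Max]) auto
  qed
  show "0 \<le> barrier_seq n h k" unfolding eq by (subst Max_ge_iff) auto
  show "barrier_seq n h k \<le> 1" unfolding eq using h by (subst Max_le_iff) (auto simp: bond_def barrier_def norm_mult)
  show "barrier_seq n h k \<le> (if k \<in> {1..int n} then h else 0)" if "k \<notin> {0, 1, int n, int n + 1}"
    unfolding eq using h that by (subst Max_le_iff) (auto simp: bond_def barrier_def norm_mult)
qed

lemma barrier_seq_0: "0 \<le> h \<Longrightarrow> h \<le> 1 \<Longrightarrow> barrier_seq n h 0 = 1"
proof (rule antisym)
  show "1 \<le> barrier_seq n h 0"
    unfolding barrier_seq_def jacobi_seq_def by (subst Max_ge_iff) (auto simp: bond_def)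
qed (rule barrier_seq_bounds)

lemma barrier_seq_lp:
  assumes h: "0 \<le> h" "h \<le> 1" and p: "p > 0"
  shows "lp_seq p (barrier_seq n h)"
    and "1 \<le> lp_norm p (barrier_seq n h) powr p"
    and "lp_norm p (barrier_seq n h) powr p \<le> 4 + real n * h powr p"
proof -
  let ?v = "barrier_seq n h" and ?S = "{0..int n + 1}" and ?E = "{0, 1, int n, int n + 1}"
  have out: "\<bar>?v k\<bar> powr p = 0" if "k \<notin> ?S" for k
  proof -
    have "?v k \<le> 0" using that barrier_seq_bounds(3)[OF h, of k n] by auto
    then show ?thesis using barrier_seq_bounds(1)[OF h, of n k] by simp
  qed
  show lp: "lp_seq p ?v" unfolding lp_seq_def
    by (subst summable_on_cong_neutral[where T = ?S and g = "\<lambda>k. \<bar>?v k\<bar> powr p"]) (auto simp: out)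
  have sum_eq: "(\<Sum>\<^sub>\<infinity>k. \<bar>?v k\<bar> powr p) = (\<Sum>k\<in>?S. \<bar>?v k\<bar> powr p)"
    by (subst infsum_cong_neutral[where T = ?S and g = "\<lambda>k. \<bar>?v k\<bar> powr p"]) (auto simp: out)
  have norm_eq: "lp_norm p ?v powr p = (\<Sum>k\<in>?S. \<bar>?v k\<bar> powr p)"
    unfolding lp_norm_def sum_eq using p by (simp add: powr_powr sum_nonneg)
  have "\<bar>?v 0\<bar> powr p \<le> (\<Sum>k\<in>?S. \<bar>?v k\<bar> powr p)"
    by (rule member_le_sum) auto
  then show "1 \<le> lp_norm p ?v powr p" unfolding norm_eq by (simp add: barrier_seq_0 h)
  have "(\<Sum>k\<in>?S. \<bar>?v k\<bar> powr p) \<le> (\<Sum>k\<in>?S. (if k \<in> ?E then 1 else 0) + (if k \<in> {1..int n} then h powr p else 0))"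
  proof (rule sum_mono)
    fix k
    show "\<bar>?v k\<bar> powr p \<le> (if k \<in> ?E then 1 else 0) + (if k \<in> {1..int n} then h powr p else 0)"
    proof (cases "k \<in> ?E")
      case True
      have "\<bar>?v k\<bar> powr p \<le> 1"
        using barrier_seq_bounds(1,2)[OF h, of n k] p by (simp add: powr_le1)
      with True show ?thesis by (simp add: add_increasing2)
    next
      case False
      have "\<bar>?v k\<bar> powr p \<le> (if k \<in> {1..int n} then h else 0) powr p"
        using barrier_seq_bounds(1)[OF h, of n k] barrier_seq_bounds(3)[OF h False] p
        by (intro powr_mono2) auto
      with False show ?thesis by auto
    qed
  qed
  also have "\<dots> = real (card (?S \<inter> ?E)) + real (card (?S \<inter> {1..int n})) * h powr p"
    by (simp add: sum.distrib sum.If_cases Int_def)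
  also have "\<dots> \<le> 4 + real n * h powr p"
  proof (intro add_mono mult_right_mono)
    have "card (?S \<inter> ?E) \<le> card ?E" by (intro card_mono) auto
    also have "\<dots> \<le> 4" by (intro order_trans[OF card_insert_le_m1] card_insert_le_m1) auto
    finally show "real (card (?S \<inter> ?E)) \<le> 4" by simp
    have "card (?S \<inter> {1..int n}) \<le> card {1..int n}" by (intro card_mono) auto
    then show "real (card (?S \<inter> {1..int n})) \<le> real n" by simp
  qed auto
  finally show "lp_norm p ?v powr p \<le> 4 + real n * h powr p" unfolding norm_eq .
qed

lemma dist_interval_ge_Im: "\<bar>Im w\<bar> \<le> dist_interval w"
proof -
  have "complex_of_real ` {-2..2} \<noteq> {}" by auto
  moreover have "\<bar>Im w\<bar> \<le> dist w (complex_of_real x)" for x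
    using abs_Im_le_cmod[of "w - of_real x"] by (simp add: dist_norm)
  ultimately show ?thesis unfolding dist_interval_def
    by (subst infdist_notempty) (auto intro!: cINF_greatest)
qed

lemma dist_interval_le_endpoints: "dist_interval w \<le> dist_endpoints w"
  unfolding dist_interval_def dist_endpoints_def
  by (rule infdist_mono) (auto intro: image_eqI[of _ _ "-2"] image_eqI[of _ _ 2])

text \<open>The contribution of a single eigenvalue to \<open>LT_sum\<close>, without its multiplicity.\<close>

definition LT_term :: "real \<Rightarrow> (real \<Rightarrow> real) \<Rightarrow> complex \<Rightarrow> real" where
  "LT_term p f w = dist_interval w powr p / cmod (w\<^sup>2 - 4) powr (1/2) *
     f (- ln (dist_interval w / dist_endpoints w))"

text \<open>Since \<open>-2\<close> and \<open>2\<close> lie in the interval, the argument of \<open>f\<close> is never negative, so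
  monotonicity bounds the value of \<open>f\<close> below by \<open>f 0\<close>.\<close>

lemma LT_term_lower_bound:
  assumes h: "0 < h" "Im w = h" and p: "p \<ge> 0"
    and f: "mono_on {0..} f" "f 0 > 0" and q: "cmod (w\<^sup>2 - 4) \<le> q\<^sup>2" "0 < q"
  shows "h powr p / q * f 0 \<le> LT_term p f w"
  unfolding LT_term_def
proof (rule mult_mono)
  have d: "h \<le> dist_interval w" using dist_interval_ge_Im[of w] h by simp
  have "w\<^sup>2 \<noteq> 4"
  proof
    assume "w\<^sup>2 = 4"
    then have "(w - 2) * (w + 2) = 0" by (simp add: power2_eq_square algebra_simps)
    then have "w = 2 \<or> w = -2" by (auto simp: eq_neg_iff_add_eq_0)
    then show False using h by auto
  qed
  then have pos: "0 < cmod (w\<^sup>2 - 4)" by simp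
  have "cmod (w\<^sup>2 - 4) powr (1/2) \<le> q"
    using q by (simp add: powr_half_sqrt real_le_lsqrt)
  then show "h powr p / q \<le> dist_interval w powr p / cmod (w\<^sup>2 - 4) powr (1/2)"
    using d h p pos by (intro frac_le powr_mono2) auto
  have "0 < dist_interval w / dist_endpoints w" "dist_interval w / dist_endpoints w \<le> 1"
    using d h dist_interval_le_endpoints[of w] by auto
  then have "0 \<le> - ln (dist_interval w / dist_endpoints w)" by simp
  then show "f 0 \<le> f (- ln (dist_interval w / dist_endpoints w))"
    using f(1) by (intro mono_onD[OF f(1)]) auto
qed (use f in auto)

lemma LT_sum_barrier:
  assumes h: "h > 0"
  shows "(\<Sum>j\<in>{1..n}. ennreal (LT_term p f (barrier_eigenvalue n h j))) \<le> LT_sum p f (barrier_op n h)"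
    (is "(\<Sum>j\<in>_. ?t (barrier_eigenvalue n h j)) \<le> _")
proof -
  let ?\<Lambda> = "barrier_eigenvalue n h ` {1..n}" and ?J = "barrier_op n h"
  have "(\<Sum>j\<in>{1..n}. ?t (barrier_eigenvalue n h j)) = (\<Sum>w\<in>?\<Lambda>. ?t w)"
    by (subst sum.reindex) (auto simp: inj_on_def intro: barrier_eigenvalue_inj)
  also have "\<dots> = (\<Sum>w\<in>?\<Lambda>. of_nat (alg_mult ?J w) * ?t w)"
    by (intro sum.cong refl) (auto simp: barrier_eigenvalue_discrete[OF h])
  also have "\<dots> = (\<Sum>\<^sub>\<infinity>w\<in>?\<Lambda>. of_nat (alg_mult ?J w) * ?t w)"
    by (subst infsum_finite) auto
  also have "\<dots> \<le> LT_sum p f ?J"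
    unfolding LT_sum_def LT_term_def
    by (rule infsum_mono_neutral)
       (auto simp: barrier_eigenvalue_discrete[OF h] intro!: nonneg_summable_on_complete)
  finally show ?thesis .
qed

lemma barrier_eigenvalue_edge_distance:
  assumes "0 \<le> h" "h \<le> 1" "0 < n"
  shows "cmod ((barrier_eigenvalue n h j)\<^sup>2 - 4) \<le> 64 * (real j / real n)\<^sup>2 + 5 * h"
proof -
  define \<theta> where "\<theta> = angle n j"
  have \<theta>: "0 \<le> \<theta>" "\<theta> \<le> 4 * (real j / real n)"
  proof -
    have "\<theta> \<le> pi * real j / real n"
      unfolding \<theta>_def angle_def using assms(3) by (intro divide_left_mono) auto
    also have "\<dots> \<le> 4 * real j / real n" 
      using pi_less_4 by (intro divide_right_mono mult_right_mono) auto
    finally show "\<theta> \<le> 4 * (real j / real n)" by simp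
  qed (simp add: \<theta>_def angle_def)
  have "(sin \<theta>)\<^sup>2 \<le> \<theta>\<^sup>2" using abs_sin_x_le_abs_x[of \<theta>] by (metis abs_le_square_iff)
  also have "\<dots> \<le> (4 * (real j / real n))\<^sup>2" using \<theta> by (intro power_mono)
  finally have s: "4 * (sin \<theta>)\<^sup>2 \<le> 64 * (real j / real n)\<^sup>2" unfolding power_mult_distrib by simp
  have "(barrier_eigenvalue n h j)\<^sup>2 - 4 = of_real (- 4 * (sin \<theta>)\<^sup>2 - h\<^sup>2) + \<i> * of_real (4 * h * cos \<theta>)"
    unfolding sin_squared_eq
    by (simp add: complex_eq_iff barrier_eigenvalue_def \<theta>_def[symmetric] power2_eq_square algebra_simps)
  then have "cmod ((barrier_eigenvalue n h j)\<^sup>2 - 4) \<le> \<bar>- 4 * (sin \<theta>)\<^sup>2 - h\<^sup>2\<bar> + \<bar>4 * h * cos \<theta>\<bar>"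
    using norm_triangle_ineq[of "of_real (- 4 * (sin \<theta>)\<^sup>2 - h\<^sup>2)" "\<i> * of_real (4 * h * cos \<theta>)"]
    by (simp only: norm_of_real norm_mult norm_ii mult_1)
  also have "\<bar>- 4 * (sin \<theta>)\<^sup>2 - h\<^sup>2\<bar> = 4 * (sin \<theta>)\<^sup>2 + h\<^sup>2"
    using zero_le_power2[of "sin \<theta>"] zero_le_power2[of h] by linarith
  also have "h\<^sup>2 \<le> h" using assms by (simp add: power2_eq_square mult_left_le)
  also have "\<bar>4 * h * cos \<theta>\<bar> \<le> 4 * h"
    using assms mult_left_mono[OF abs_cos_le_one, of "4 * h" \<theta>] by (simp add: abs_mult)
  finally show ?thesis using s by simp
qed

lemma harmonic_sum_ge_ln:
  assumes "0 < K" "K \<le> n"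
  shows "ln (real (n + 1) / real K) \<le> (\<Sum>j\<in>{K..n}. 1 / real j)"
  using assms(2)
proof (induction n rule: dec_induct)
  case base
  have "ln (1 + 1 / real K) \<le> 1 / real K" by (rule ln_add_one_self_le_self) simp
  moreover have "1 + 1 / real K = real (K + 1) / real K" using assms(1) by (simp add: field_simps)
  ultimately show ?case by simp
next
  case (step n)
  have "1 + 1 / real (n + 1) = real (Suc n + 1) / real (n + 1)" by (simp add: field_simps)
  then have "real (Suc n + 1) / real K = (real (n + 1) / real K) * (1 + 1 / real (n + 1))"
    by (simp only:) simp
  then have "ln (real (Suc n + 1) / real K) = ln ((real (n + 1) / real K) * (1 + 1 / real (n + 1)))"
    by (rule arg_cong)
  also have "\<dots> = ln (real (n + 1) / real K) + ln (1 + 1 / real (n + 1))"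
    using assms(1) by (intro ln_mult_pos) (auto simp: add_pos_pos)
  also have "ln (1 + 1 / real (n + 1)) \<le> 1 / real (n + 1)"
    by (rule ln_add_one_self_le_self) simp
  also have "ln (real (n + 1) / real K) + 1 / real (n + 1) \<le> (\<Sum>j\<in>{K..n}. 1 / real j) + 1 / real (n + 1)"
    using step.IH by simp
  also have "\<dots> = (\<Sum>j\<in>{K..Suc n}. 1 / real j)" using step.hyps by simp
  finally show ?case by simp
qed

text \<open>Take \<open>h = 1 / m\<^sup>2\<close> and \<open>n = m K\<close>. For \<open>j \<ge> K\<close> one has \<open>h \<le> (j / n)\<^sup>2\<close>, so the eigenvalue with
  index \<open>j\<close> contributes at least \<open>f 0\<close> times \<open>h\<^sup>p n / (9 j)\<close>. Summing over these \<open>j\<close> gives a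
  multiple of \<open>n h\<^sup>p ln m\<close>, while the cost of the two cuts in the norm is bounded.\<close>

lemma LT_sup_ge_ln:
  fixes m :: nat
  assumes p: "p > 0" and f: "mono_on {0..} f" "f 0 > 0" and m: "m \<ge> 1"
  shows "ennreal (f 0 * ln (real m) / 18) \<le> LT_sup p f"
proof -
  define h where "h = 1 / (real m)\<^sup>2"
  have h: "0 < h" "h \<le> 1" using m by (auto simp: h_def field_simps)
  \<comment> \<open>\<open>K\<close> is so large that \<open>n h\<^sup>p \<ge> 4\<close>: the barrier outweighs the cuts in the norm.\<close>
  obtain K0 :: nat where K0: "4 / (real m * h powr p) < real K0" using reals_Archimedean2 by blast
  define K where "K = max 1 K0"
  define n where "n = m * K"
  have K: "0 < K" "K \<le> n" using mult_le_mono1[OF m, of K] by (auto simp: K_def n_def)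
  have n: "0 < n" using K by simp
  have "4 < real K0 * (real m * h powr p)"
    using K0 h m by (subst (asm) pos_divide_less_eq) auto
  also have "\<dots> \<le> real K * (real m * h powr p)" by (intro mult_right_mono) (auto simp: K_def)
  finally have big: "4 \<le> real n * h powr p" by (simp add: n_def mult_ac)
  have summand: "ennreal (real n * h powr p * f 0 / 9 * (1 / real j)) \<le>
      ennreal (LT_term p f (barrier_eigenvalue n h j))"
    if j: "j \<in> {K..n}" for j
  proof -
    have "real K / real n = 1 / real m" using K m by (simp add: n_def)
    then have "h = (real K / real n)\<^sup>2" by (simp add: h_def power_divide)
    also have "\<dots> \<le> (real j / real n)\<^sup>2" using j by (intro power_mono divide_right_mono) auto
    finally have "h \<le> (real j / real n)\<^sup>2" .
    moreover have "(9 * (real j / real n))\<^sup>2 = 81 * (real j / real n)\<^sup>2"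
      unfolding power_mult_distrib by simp
    ultimately have "64 * (real j / real n)\<^sup>2 + 5 * h \<le> (9 * (real j / real n))\<^sup>2"
      using zero_le_power2[of "real j / real n"] by linarith
    then have "cmod ((barrier_eigenvalue n h j)\<^sup>2 - 4) \<le> (9 * (real j / real n))\<^sup>2"
      using barrier_eigenvalue_edge_distance[of h n j] h n by linarith
    then have "h powr p / (9 * (real j / real n)) * f 0 \<le> LT_term p f (barrier_eigenvalue n h j)"
      using h p f j K by (intro LT_term_lower_bound) (auto simp: barrier_eigenvalue_def)
    then show ?thesis by (intro ennreal_leI) (simp add: mult_ac)
  qed
  have "ln (real m) \<le> ln (real (n + 1) / real K)"
    using m K by (subst ln_le_cancel_iff) (auto simp: n_def field_simps intro!: add_pos_nonneg)
  also have "\<dots> \<le> (\<Sum>j\<in>{K..n}. 1 / real j)" by (rule harmonic_sum_ge_ln[OF K])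
  finally have "real n * h powr p * f 0 / 9 * ln (real m) \<le> (\<Sum>j\<in>{K..n}. real n * h powr p * f 0 / 9 * (1 / real j))"
    unfolding sum_distrib_left[symmetric] using f by (intro mult_left_mono) auto
  then have "ennreal (real n * h powr p * f 0 / 9 * ln (real m)) 
      \<le> (\<Sum>j\<in>{K..n}. ennreal (real n * h powr p * f 0 / 9 * (1 / real j)))"
    using f by (subst sum_ennreal) (auto intro: ennreal_leI)
  also have "\<dots> \<le> (\<Sum>j\<in>{K..n}. ennreal (LT_term p f (barrier_eigenvalue n h j)))"
    by (rule sum_mono[OF summand])
  also have "\<dots> \<le> (\<Sum>j\<in>{1..n}. ennreal (LT_term p f (barrier_eigenvalue n h j)))"
    using K by (intro sum_mono2) auto
  also have "\<dots> \<le> LT_sum p f (barrier_op n h)" by (rule LT_sum_barrier[OF h(1)])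
  finally have sum: "ennreal (real n * h powr p * f 0 / 9 * ln (real m)) \<le> LT_sum p f (barrier_op n h)" .
  define N where "N = lp_norm p (barrier_seq n h) powr p"
  have N: "1 \<le> N" "N \<le> 2 * (real n * h powr p)"
    using barrier_seq_lp(2,3)[of h p n] h p big by (auto simp: N_def)
  have "f 0 * ln (real m) / 18 = 1 / (2 * (real n * h powr p)) * (real n * h powr p * f 0 / 9 * ln (real m))"
    using h n by simp
  also have "\<dots> \<le> 1 / N * (real n * h powr p * f 0 / 9 * ln (real m))"
    using N f m by (intro mult_right_mono divide_left_mono) auto
  finally have "ennreal (f 0 * ln (real m) / 18) \<le> ennreal (1 / N * (real n * h powr p * f 0 / 9 * ln (real m)))"
    by (rule ennreal_leI)
  also have "\<dots> = ennreal (1 / N) * ennreal (real n * h powr p * f 0 / 9 * ln (real m))"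
    using N f m by (intro ennreal_mult) auto
  also have "\<dots> \<le> ennreal (1 / N) * LT_sum p f (barrier_op n h)"
    by (rule mult_left_mono[OF sum]) simp
  also have "\<dots> \<le> LT_sup p f"
  proof -
    let ?a = "\<lambda>k. complex_of_real (bond n k)"
    have "range ?a \<subseteq> {0, 1}" "range (barrier n h) \<subseteq> {0, \<i> * of_real h}"
      by (auto simp: bond_def barrier_def)
    then have "bounded (range ?a)" "bounded (range (barrier n h))"
      by (meson finite.intros finite_imp_bounded finite_subset)+
    moreover have "jacobi_seq ?a (barrier n h) ?a \<noteq> (\<lambda>n. 0)"
      using barrier_seq_0[of h n] h unfolding barrier_seq_def by (metis less_imp_le zero_neq_one)
    moreover have "lp_seq p (jacobi_seq ?a (barrier n h) ?a)"
      using barrier_seq_lp(1)[of h p n] h p unfolding barrier_seq_def by simp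
    ultimately show ?thesis
      unfolding LT_sup_def N_def barrier_seq_def barrier_op_def
      by (intro SUP_upper2[of "(?a, barrier n h, ?a)"]) auto
  qed
  finally show ?thesis .
qed

lemma LT_sup_eq_top:
  assumes p: "p > 0" and f: "mono_on {0..} f" "f 0 > 0"
  shows "LT_sup p f = top"
proof (cases "LT_sup p f")
  case (real r)
  obtain m :: nat where m: "exp (18 * (r + 1) / f 0) < real m" using reals_Archimedean2 by blast
  moreover have "1 < exp (18 * (r + 1) / f 0)" using real f by simp
  ultimately have m1: "m \<ge> 1" by linarith
  have "18 * (r + 1) / f 0 < ln (real m)" using m m1 by (subst exp_less_cancel_iff[symmetric]) simp
  then have "r + 1 < f 0 * ln (real m) / 18" using f by (simp add: field_simps)
  moreover have "f 0 * ln (real m) / 18 \<le> r"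
    using LT_sup_ge_ln[OF p f m1] real by (simp add: ennreal_le_iff)
  ultimately show ?thesis by simp
qed

lemma primitive_diff_ge:
  assumes cont: "continuous_on {0..} f" and mono: "mono_on {0..} f" and ab: "0 \<le> a" "a \<le> b"
  shows "f 0 * (b - a) \<le> primitive f b - primitive f a"
proof -
  have int: "f integrable_on {x..y}" if "0 \<le> x" for x y
    by (rule integrable_continuous_real, rule continuous_on_subset[OF cont]) (use that in auto)
  have "integral {0..a} f + integral {a..b} f = integral {0..b} f"
    by (rule Henstock_Kurzweil_Integration.integral_combine) (use ab int in auto)
  moreover have "integral {a..b} (\<lambda>x. f 0) \<le> integral {a..b} f"
    using ab by (intro integral_le int) (auto intro!: mono_onD[OF mono])
  ultimately show ?thesis using ab by (simp add: primitive_def mult.commute)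
qed

theorem theorem3p5:
  fixes p :: real
  assumes "p \<ge> 1"
  shows "\<exists>C>0. \<forall>(\<epsilon>::real) (\<gamma>::real) (x0::real) (g::real \<Rightarrow> real).
    0 < \<epsilon> \<and> \<epsilon> < 2/3 \<and> 2/3 < \<gamma> \<and> \<gamma> < 1 \<and> x0 \<ge> 1 \<and>
    (\<forall>x\<ge>1. g x \<ge> 1) \<and>
    filterlim (\<lambda>n. g (real n)) at_top sequentially \<and>
    (\<lambda>n. g (real n) / real n powr (\<gamma> - 2/3)) \<longlonglongrightarrow> 0 \<longrightarrow>
    (\<exists>N\<ge>2. \<forall>n\<ge>(N::nat). \<forall>f::real \<Rightarrow> real.
       continuous_on {0..} f \<and> mono_on {0..} f \<and> (\<forall>x\<ge>0. f x > 0) \<and>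
       (mono_on {x0..} (\<lambda>t. f (ln (t\<^sup>2)) / t) \<or> antimono_on {x0..} (\<lambda>t. f (ln (t\<^sup>2)) / t)) \<longrightarrow>
       ennreal (C * (primitive f (ln (pi\<^sup>2 * real n powr \<epsilon>)) - primitive f (ln (pi\<^sup>2 * (g (real n))\<^sup>2))))
         \<le> LT_sup p f \<and>
       ennreal (C * f 0 * ln (real n powr \<epsilon> / (g (real n))\<^sup>2)) \<le> LT_sup p f \<and>
       ((g (real n))\<^sup>2 \<le> real n powr \<epsilon> \<longrightarrow>
          C * f 0 * ln (real n powr \<epsilon> / (g (real n))\<^sup>2)
          \<le> C * (primitive f (ln (pi\<^sup>2 * real n powr \<epsilon>)) - primitive f (ln (pi\<^sup>2 * (g (real n))\<^sup>2)))))"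
  \<comment> \<open>As the supremum is infinite, only the comparison of the two lower bounds needs an estimate.\<close>
proof (rule exI[of _ 1], safe)
  fix \<epsilon> \<gamma> x0 :: real and g :: "real \<Rightarrow> real"
  assume g: "\<forall>x\<ge>1. g x \<ge> 1"
  have sup_top: "LT_sup p f = top" if "mono_on {0..} f" "\<forall>x\<ge>0. f x > 0" for f :: "real \<Rightarrow> real"
    using LT_sup_eq_top[of p f] assms that by auto
  have lower: "f 0 * ln (real n powr \<epsilon> / (g (real n))\<^sup>2) \<le>
      primitive f (ln (pi\<^sup>2 * real n powr \<epsilon>)) - primitive f (ln (pi\<^sup>2 * (g (real n))\<^sup>2))"
    if f: "continuous_on {0..} f" "mono_on {0..} f" and n: "2 \<le> n" and le: "(g (real n))\<^sup>2 \<le> real n powr \<epsilon>"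
    for f :: "real \<Rightarrow> real" and n :: nat
  proof -
    have g1: "1 \<le> (g (real n))\<^sup>2" using g n by (simp add: one_le_power)
    have pos: "0 < (g (real n))\<^sup>2" "0 < real n powr \<epsilon>" using g1 n by auto
    have "1 * 1 \<le> pi\<^sup>2 * (g (real n))\<^sup>2"
      using pi_gt3 by (intro mult_mono[OF one_le_power g1]) auto
    then have a: "0 \<le> ln (pi\<^sup>2 * (g (real n))\<^sup>2)" by simp
    have b: "ln (pi\<^sup>2 * (g (real n))\<^sup>2) \<le> ln (pi\<^sup>2 * real n powr \<epsilon>)"
      using pos le by (subst ln_le_cancel_iff) (auto intro!: mult_pos_pos)
    have "ln (real n powr \<epsilon> / (g (real n))\<^sup>2) = ln (pi\<^sup>2 * real n powr \<epsilon>) - ln (pi\<^sup>2 * (g (real n))\<^sup>2)"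
      using pos by (simp only: ln_mult_pos ln_div zero_less_power pi_gt_zero) simp
    then show ?thesis using primitive_diff_ge[OF f a b] by simp
  qed
  show "\<exists>N\<ge>2. \<forall>n\<ge>(N::nat). \<forall>f::real \<Rightarrow> real.
       continuous_on {0..} f \<and> mono_on {0..} f \<and> (\<forall>x\<ge>0. f x > 0) \<and>
       (mono_on {x0..} (\<lambda>t. f (ln (t\<^sup>2)) / t) \<or> antimono_on {x0..} (\<lambda>t. f (ln (t\<^sup>2)) / t)) \<longrightarrow>
       ennreal (1 * (primitive f (ln (pi\<^sup>2 * real n powr \<epsilon>)) - primitive f (ln (pi\<^sup>2 * (g (real n))\<^sup>2))))
         \<le> LT_sup p f \<and>
       ennreal (1 * f 0 * ln (real n powr \<epsilon> / (g (real n))\<^sup>2)) \<le> LT_sup p f \<and>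
       ((g (real n))\<^sup>2 \<le> real n powr \<epsilon> \<longrightarrow>
          1 * f 0 * ln (real n powr \<epsilon> / (g (real n))\<^sup>2)
          \<le> 1 * (primitive f (ln (pi\<^sup>2 * real n powr \<epsilon>)) - primitive f (ln (pi\<^sup>2 * (g (real n))\<^sup>2))))"
    using sup_top lower by (intro exI[of _ 2]) auto
qed simp

end
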